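(* Let $d\ge p\ge1$ be integers and let $B\in\mathbb{R}^{d\times p}$ be of rank $p$. Let $\beta_{(1)}\ge\cdots\ge\beta_{(p)}$ denote the ordered eigenvalues of $\tfrac14B'B$, let $N_p=\tfrac12(p+2)(p-1)$, and, for an integer $m \ge 1$, let $$\mu=\left(\frac{1+m}{2+m}\right)^{N_p}2p\,\beta_{(p)}\,\mathrm{e}^{-1}.$$ Then for all integers $m\ge1$, $$\Psi_{d,p;m}(B)\ \ge\ \frac{(1+m)^{-N_p}(d+m)^{-m}(2p\beta_{(p)})^m}{m!}\;{}_1F_2(1;\,m+1,\,d+1+m;\,\mu).$$
   Context: $B'$ denotes the transpose of $B$. The classical generalized hypergeometric function is ${}_1F_2(a;b,c;z)=\sum_{k=0}^\infty\frac{(a)_k}{(b)_k(c)_k}\frac{z^k}{k!}$, where $(a)_k = a(a+1)\cdots(a+k-1)$, $(a)_0=1$. Partitions: a partition $\kappa=(\kappa_1,\kappa_2,\ldots)$ is a weakly decreasing sequence of nonnegative integers with finitely many non-zero entries (trailing zeros are immaterial); its length $\ell(\kappa)$ is the number of non-zero $\kappa_j$ and its weight is $|\kappa|=\sum_j\kappa_j$. The partitional shifted factorial is $(a)_\kappa = \prod_{i\ge1} \bigl(a-\tfrac12(i-1)\bigr)_{\kappa_i}$. Zonal polynomials: for an $n\times n$ real symmetric matrix $S$ and a partition $\kappa$ with $\ell(\kappa)\le n$, $$C_\kappa(S) = C_\kappa(I_n)\int_{\mathrm{O}(n)} \prod_{j=1}^{\ell(\kappa)} \bigl[\det{}_j(H'SH)\bigr]^{\kappa_j-\kappa_{j+1}}\,dH,$$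 where $\det_j$ is the leading $j\times j$ principal minor, $dH$ is normalized Haar measure on the orthogonal group $\mathrm{O}(n)$, zeroth powers equal $1$, and $$C_\kappa(I_n) = 2^{2|\kappa|}\,|\kappa|!\,(n/2)_\kappa\, \frac{\prod_{1\le i<j\le \ell(\kappa)} (2\kappa_i-2\kappa_j-i+j)}{\prod_{i=1}^{\ell(\kappa)} (2\kappa_i+\ell(\kappa)-i)!}.$$ (With this normalization $(\mathrm{tr}\,S)^k=\sum_{|\kappa|=k}C_\kappa(S)$, the sum being over $\ell(\kappa)\le n$.) Remainder: the normalizing constant of the matrix Langevin distribution on the Stiefel manifold $V_{d,p}=\{x\in\mathbb{R}^{d\times p}:x'x=I_p\}$ with density proportional to $\exp(\mathrm{tr}\,B'x)$ with respect to the invariant probability measure is $$\Psi_{d,p}(B)=\sum_{k=0}^\infty\frac1{k!}\sum_{|\kappa|=k}\frac{C_\kappa(\frac14B'B)}{(d/2)_\kappa},$$ the inner sum being over partitions with $\ell(\kappa)\le p$; the remainder after truncation is $$\Psi_{d,p;m}(B)=\sum_{k=m}^\infty\frac1{k!}\sum_{|\kappa|=k}\frac{C_\kappa(\frac14B'B)}{(d/2)_\kappa},$$ again with $\ell(\kappa)\le p$ (the series converges absolutely). *)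

theory Defs
  imports "HOL-Probability.Probability"
begin

text \<open>
  A \<open>p \<times> p\<close> matrix is an element of \<open>real^'p^'p\<close>, where the order on the index type
  \<open>'p :: {finite,wellorder}\<close> says which rows and columns come first. A partition is a function on
  \<open>nat\<close> indexed from 0: its value at \<open>i\<close> is the part that is usually written with index \<open>i + 1\<close>.
\<close>

definition orthogonal_group :: "(real^'n^'n) set" where
  "orthogonal_group = {Q. orthogonal_matrix Q}"

definition normalized_haar :: "(real^'n^'n) measure \<Rightarrow> bool" where
  "normalized_haar \<nu> \<longleftrightarrow>
     sets \<nu> = sets (restrict_space borel orthogonal_group) \<and>
     prob_space \<nu> \<and>
     (\<forall>Q\<in>orthogonal_group. distr \<nu> \<nu> (\<lambda>H. Q ** H) = \<nu>)"

definition haar_orthogonal :: "(real^'n^'n) measure" where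
  "haar_orthogonal = (SOME \<nu>. normalized_haar \<nu>)"

text \<open>
  Existence, so that the choice above is meaningful: apply the Gram-Schmidt process to the columns
  of a random matrix whose columns are independent and uniform in the unit ball, conditioned on
  invertibility.
\<close>

function gram_schmidt_col ::
    "('n::{finite,wellorder} \<Rightarrow> real^'n::_) \<Rightarrow> 'n \<Rightarrow> real^'n::_" where
  "gram_schmidt_col v j =
     (let w = v j - (\<Sum>k\<in>{..<j}. (v j \<bullet> gram_schmidt_col v k) *\<^sub>R gram_schmidt_col v k)
      in w /\<^sub>R norm w)"
  by pat_completeness auto
termination
  by (relation "inv_image {(a, b). a < b} snd") (auto intro: wf)

declare gram_schmidt_col.simps [simp del]

lemma gram_schmidt_col_measurable [measurable]:
  "(\<lambda>v. gram_schmidt_col v j) \<in> borel_measurable (PiM UNIV (\<lambda>_::'n::{finite,wellorder}. borel))"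
proof (induction j rule: less_induct)
  case (less j)
  have [measurable]: "(\<lambda>v. v j) \<in> borel_measurable (PiM UNIV (\<lambda>_::'n. borel :: (real^'n::_) measure))"
    by measurable
  have [measurable]: "(\<lambda>v. \<Sum>k\<in>{..<j}. (v j \<bullet> gram_schmidt_col v k) *\<^sub>R gram_schmidt_col v k)
      \<in> borel_measurable (PiM UNIV (\<lambda>_::'n. borel))"
    using less by (intro borel_measurable_sum borel_measurable_scaleR borel_measurable_inner) auto
  show ?case
    by (subst gram_schmidt_col.simps) (simp add: Let_def)
qed

lemma gram_schmidt_col_equivariant:
  fixes Q :: "real^'n::{finite,wellorder}^'n::_"
  assumes "orthogonal_matrix Q"
  shows "gram_schmidt_col (\<lambda>j. Q *v v j) j = Q *v gram_schmidt_col v j"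
proof (induction j rule: less_induct)
  case (less j)
  have orth: "orthogonal_transformation ((*v) Q)"
    using assms by (simp add: orthogonal_transformation_matrix)
  have inner: "(Q *v x) \<bullet> (Q *v y) = x \<bullet> y" for x y
    using orth by (simp add: orthogonal_transformation_def)
  have norm: "norm (Q *v x) = norm x" for x
    using orth by (simp add: orthogonal_transformation_norm)
  let ?S = "\<lambda>v. \<Sum>k\<in>{..<j}. (v j \<bullet> gram_schmidt_col v k) *\<^sub>R gram_schmidt_col v k"
  have "?S (\<lambda>j. Q *v v j) = Q *v ?S v"
    using less by (simp add: linear_sum[OF matrix_vector_mul_linear] inner
        scaleR_matrix_vector_assoc[symmetric] matrix_vector_mult_scaleR)
  then show ?case
    by (subst (1 2) gram_schmidt_col.simps)
      (simp add: Let_def norm matrix_vector_mult_scaleR matrix_vector_mult_diff_distrib[symmetric])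
qed

lemma gram_schmidt_col_orthonormal:
  fixes v :: "'n::{finite,wellorder} \<Rightarrow> real^'n::_"
  assumes det: "det (\<chi> i. v i) \<noteq> 0"
  shows "norm (gram_schmidt_col v j) = 1 \<and> gram_schmidt_col v j \<in> span (v ` {..j}) \<and>
         (\<forall>i<j. gram_schmidt_col v i \<bullet> gram_schmidt_col v j = 0)"
proof (induction j rule: less_induct)
  case (less j)
  let ?g = "gram_schmidt_col v"
  define w where "w = v j - (\<Sum>k\<in>{..<j}. (v j \<bullet> ?g k) *\<^sub>R ?g k)"
  have g: "?g j = w /\<^sub>R norm w"
    by (subst gram_schmidt_col.simps) (simp add: w_def Let_def)
  have gsp: "?g k \<in> span (v ` {..<j})" if "k < j" for k
  proof -
    have "v ` {..k} \<subseteq> v ` {..<j}" using that by auto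
    with less[OF that] span_mono show ?thesis by blast
  qed
  have S: "(\<Sum>k\<in>{..<j}. (v j \<bullet> ?g k) *\<^sub>R ?g k) \<in> span (v ` {..<j})"
    by (intro span_sum span_scale gsp) auto
  have "w \<noteq> 0"
  proof
    assume "w = 0"
    then have "v j \<in> span (v ` {..<j})" using S by (simp add: w_def)
    moreover have "v ` {..<j} \<subseteq> {row k (\<chi> i. v i) |k. k \<noteq> j}"
      by (auto simp: row_def vec_eq_iff)
    ultimately have "v j \<in> span {row k (\<chi> i. v i) |k. k \<noteq> j}"
      using span_mono by blast
    then have "- v j \<in> vec.span {row k (\<chi> i. v i) |k. k \<noteq> j}"
      by (simp add: span_neg span_vec_eq)
    from det_row_span[OF this]
    have "det (\<chi> i. v i) = det (\<chi> k. if k = j then 0 else v k)"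
      by (simp add: row_def vec_nth_inverse cong: if_cong)
    also have "\<dots> = 0"
      by (rule det_zero_row(1)[of j]) (simp add: row_def vec_eq_iff)
    finally show False using det by simp
  qed
  have "w \<in> span (v ` {..j})"
  proof -
    have "v ` {..<j} \<subseteq> v ` {..j}" by auto
    then have "(\<Sum>k\<in>{..<j}. (v j \<bullet> ?g k) *\<^sub>R ?g k) \<in> span (v ` {..j})"
      using S span_mono by blast
    then show ?thesis unfolding w_def by (intro span_diff) (auto intro: span_base)
  qed
  moreover have "?g i \<bullet> w = 0" if i: "i < j" for i
  proof -
    have 1: "?g i \<bullet> ?g k = (if k = i then 1 else 0)" if "k < j" for k
    proof (cases i k rule: linorder_cases)
      case less': less
      then show ?thesis using less[OF that] by auto
    next
      case equal
      then show ?thesis using less[OF that] by (simp add: dot_square_norm)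
    next
      case greater
      then show ?thesis using less[OF i] by (auto simp: inner_commute)
    qed
    have "?g i \<bullet> (\<Sum>k\<in>{..<j}. (v j \<bullet> ?g k) *\<^sub>R ?g k)
        = (\<Sum>k\<in>{..<j}. if k = i then v j \<bullet> ?g k else 0)"
      unfolding inner_sum_right by (rule sum.cong) (auto simp: 1)
    also have "\<dots> = ?g i \<bullet> v j" using i by (simp add: inner_commute)
    finally show ?thesis by (simp add: w_def inner_diff_right)
  qed
  ultimately show ?case
    using \<open>w \<noteq> 0\<close> by (simp add: g span_scale)
qed

lemma emeasure_lborel_orthogonal_vimage:
  fixes Q :: "real^'n::{finite,wellorder}^'n::_"
  assumes "orthogonal_matrix Q" and A: "A \<in> sets borel" "bounded A"
  shows "emeasure lborel ((*v) Q -` A) = emeasure lborel A"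
proof -
  let ?R = "(*v) (transpose Q)"
  have orth: "orthogonal_transformation ?R"
    using assms by (simp add: orthogonal_transformation_matrix)
  have inv: "Q *v (transpose Q *v x) = x" "transpose Q *v (Q *v x) = x" for x
    using assms by (simp_all add: matrix_vector_mul_assoc orthogonal_matrix_def
        del: transpose_matrix_vector)
  have img: "(*v) Q -` A = ?R ` A"
    by (auto simp: image_def inv simp del: transpose_matrix_vector) (metis inv)
  have AL: "A \<in> lmeasurable"
    using A by (intro bounded_set_imp_lmeasurable) auto
  have B: "(*v) Q -` A \<in> sets borel"
    using measurable_sets[of "(*v) Q" borel borel A] A
    by (simp add: borel_measurable_continuous_onI linear_continuous_on linear_linear)
  have "emeasure lebesgue (?R ` A) = emeasure lebesgue A"
    using measurable_orthogonal_image[OF orth AL] measure_orthogonal_image[OF orth AL] AL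
    by (simp add: emeasure_eq_measure2)
  then show ?thesis
    using A B by (simp add: img)
qed

lemma uniform_ball_orthogonal_invariant:
  fixes Q :: "real^'n::{finite,wellorder}^'n::_"
  assumes Q: "orthogonal_matrix Q"
  defines "D \<equiv> uniform_measure lborel (ball 0 1 :: (real^'n::_) set)"
  assumes X: "X \<in> sets borel"
  shows "emeasure D ((*v) Q -` X) = emeasure D X"
proof -
  have orth: "orthogonal_transformation ((*v) Q)"
    using Q by (simp add: orthogonal_transformation_matrix)
  have V: "(*v) Q -` X \<in> sets borel"
    using measurable_sets[of "(*v) Q" borel borel X] X
    by (simp add: borel_measurable_continuous_onI linear_continuous_on linear_linear)
  have "ball 0 1 \<inter> (*v) Q -` X = (*v) Q -` (ball 0 1 \<inter> X)"
    by (auto simp: orthogonal_transformation_norm[OF orth])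
  moreover have "emeasure lborel ((*v) Q -` (ball 0 1 \<inter> X)) = emeasure lborel (ball 0 1 \<inter> X)"
    using X by (intro emeasure_lborel_orthogonal_vimage[OF Q]) auto
  ultimately show ?thesis
    using X V by (simp add: D_def)
qed

lemma normalized_haar_exists:
  "\<exists>\<nu> :: (real^'n::{finite,wellorder}^'n::_) measure. normalized_haar \<nu>"
proof -
  define D where "D = uniform_measure lborel (ball 0 1 :: (real^'n::_) set)"
  have ball_pos: "emeasure lborel (ball 0 1 :: (real^'n::_) set) \<noteq> 0"
    using open_not_negligible[of "ball 0 1 :: (real^'n::_) set"]
    by (auto simp: negligible_iff_null_sets null_sets_def)
  have ball_fin: "emeasure lborel (ball 0 1 :: (real^'n::_) set) \<noteq> \<infinity>"
    using emeasure_lborel_ball_finite[of 0 1] by (metis less_irrefl infinity_ennreal_def)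
  interpret D: prob_space D
    unfolding D_def by (rule prob_space_uniform_measure[OF ball_pos ball_fin])
  have sets_D [measurable_cong]: "sets D = sets borel" by (simp add: D_def)
  interpret P: product_prob_space "\<lambda>_::'n. D" UNIV ..
  define M where "M = PiM UNIV (\<lambda>_::'n. D)"
  interpret M: prob_space M unfolding M_def by (rule P.prob_space_axioms)
  have sets_M [measurable_cong]: "sets M = sets (PiM UNIV (\<lambda>_::'n. borel))"
    unfolding M_def by (rule sets_PiM_cong) (auto simp: sets_D)
  have space_M [simp]: "space M = UNIV"
    using sets_eq_imp_space_eq[OF sets_M] by (simp add: space_PiM)
  have comp [measurable]: "(\<lambda>v. v j) \<in> borel_measurable M" for j
    unfolding measurable_cong_sets[OF sets_M refl] by measurable
  have comp2 [measurable]: "(\<lambda>v. v j $ i) \<in> borel_measurable M" for i j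
    using borel_measurable_continuous_onI[OF continuous_on_component[OF continuous_on_id, of UNIV i]] comp
    by (rule measurable_compose_rev)
  define E where "E = {v :: 'n \<Rightarrow> real^'n::_. det (\<chi> i. v i) \<noteq> 0}"
  have E_sets [measurable]: "E \<in> sets M"
  proof -
    have "(\<lambda>v. det (\<chi> i. v i)) \<in> borel_measurable M"
      unfolding det_def by (simp, measurable)
    then have "{v \<in> space M. det (\<chi> i. v i) \<noteq> 0} \<in> sets M" by measurable
    then show ?thesis by (simp add: E_def)
  qed

  have E_pos: "emeasure M E \<noteq> 0"
  proof -
    define I2 where "I2 = ((1/2) *\<^sub>R mat 1 :: real^'n::_^'n::_)"
    have "continuous_on UNIV (det :: real^'n::_^'n::_ \<Rightarrow> real)"
      unfolding det_def by (intro continuous_intros)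
    then have "open {A :: real^'n::_^'n::_. det A \<noteq> 0}"
      by (intro open_Collect_neq) auto
    moreover have "det I2 \<noteq> 0"
      by (subst det_diagonal) (auto simp: I2_def mat_def)
    ultimately obtain e where e: "e > 0" "ball I2 e \<subseteq> {A. det A \<noteq> 0}"
      unfolding open_contains_ball by blast
    define d where "d = e / CARD('n)"
    have "d > 0" using e by (simp add: d_def)
    have sub: "Pi\<^sub>E UNIV (\<lambda>i. ball (I2 $ i) d) \<subseteq> E"
    proof
      fix v assume v: "v \<in> Pi\<^sub>E UNIV (\<lambda>i. ball (I2 $ i) d)"
      have "dist I2 (\<chi> i. v i) \<le> (\<Sum>i\<in>UNIV. dist (I2 $ i) (v i))"
        unfolding dist_vec_def by (rule order_trans[OF L2_set_le_sum]) auto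
      also have "\<dots> < (\<Sum>i\<in>(UNIV :: 'n set). d)"
        using v by (intro sum_strict_mono) (auto simp: PiE_iff)
      finally have "(\<chi> i. v i) \<in> ball I2 e" by (simp add: d_def)
      then show "v \<in> E" using e by (auto simp: E_def)
    qed
    have "emeasure D (ball (I2 $ i) d) \<noteq> 0" for i
    proof -
      have "norm (I2 $ i) < 1"
      proof -
        have "I2 $ i = (1/2) *\<^sub>R axis i 1"
          by (auto simp: I2_def mat_def axis_def vec_eq_iff)
        then show ?thesis by (simp add: norm_axis_1)
      qed
      then have "ball 0 1 \<inter> ball (I2 $ i) d \<noteq> {}" "open (ball 0 1 \<inter> ball (I2 $ i) d)"
        using \<open>d > 0\<close> by (auto intro!: exI[of _ "I2 $ i"] simp: set_eq_iff)
      then have "emeasure lborel (ball 0 1 \<inter> ball (I2 $ i) d) \<noteq> 0"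
        using open_not_negligible
        by (metis borel_open negligible_iff_null_sets null_setsI null_sets_completionI sets_lborel)
      then show ?thesis
        using ball_fin by (simp add: D_def ennreal_divide_eq_0_iff)
    qed
    then have "(\<Prod>i\<in>(UNIV :: 'n set). emeasure D (ball (I2 $ i) d)) \<noteq> 0"
      by (simp add: prod_zero_iff)
    moreover have "emeasure M (Pi\<^sub>E UNIV (\<lambda>i. ball (I2 $ i) d))
        = (\<Prod>i\<in>(UNIV :: 'n set). emeasure D (ball (I2 $ i) d))"
      unfolding M_def by (rule P.emeasure_PiM) (auto simp: sets_D)
    ultimately show ?thesis
      using emeasure_mono[OF sub E_sets] by auto
  qed

  have T_meas: "(\<lambda>v j. Q *v v j) \<in> measurable M M" for Q :: "real^'n::_^'n::_"
  proof -
    have [measurable]: "(*v) Q \<in> borel_measurable borel"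
      by (simp add: borel_measurable_continuous_onI linear_continuous_on linear_linear)
    show ?thesis
      unfolding measurable_cong_sets[OF refl sets_M]
      by (rule measurable_PiM_single') (auto simp: space_PiM)
  qed
  have M_inv: "distr M M (\<lambda>v j. Q *v v j) = M" if Q: "orthogonal_matrix Q" for Q :: "real^'n::_^'n::_"
    unfolding M_def
  proof (rule P.PiM_eqI)
    fix A :: "'n \<Rightarrow> (real^'n::_) set" assume A: "\<And>i. i \<in> UNIV \<Longrightarrow> A i \<in> sets D"
    have V: "(*v) Q -` A i \<in> sets D" for i
      using measurable_sets[of "(*v) Q" borel borel "A i"] A[of i]
      by (simp add: sets_D borel_measurable_continuous_onI linear_continuous_on linear_linear)
    have "emeasure (distr M M (\<lambda>v j. Q *v v j)) (Pi\<^sub>E UNIV A)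
        = emeasure M ((\<lambda>v j. Q *v v j) -` Pi\<^sub>E UNIV A)"
      using A T_meas by (subst emeasure_distr) (auto simp: M_def space_M[unfolded M_def] intro!: sets_PiM_I_finite)
    also have "(\<lambda>v j. Q *v v j) -` Pi\<^sub>E UNIV A = Pi\<^sub>E UNIV (\<lambda>i. (*v) Q -` A i)"
      by (auto simp: PiE_iff)
    also have "emeasure M \<dots> = (\<Prod>i\<in>UNIV. emeasure D ((*v) Q -` A i))"
      unfolding M_def using V by (intro P.emeasure_PiM) auto
    also have "\<dots> = (\<Prod>i\<in>UNIV. emeasure D (A i))"
      using A uniform_ball_orthogonal_invariant[OF Q] by (auto simp: D_def intro!: prod.cong)
    finally show "emeasure (distr (PiM UNIV (\<lambda>_. D)) (PiM UNIV (\<lambda>_. D)) (\<lambda>v j. Q *v v j)) (Pi\<^sub>E UNIV A)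
        = (\<Prod>i\<in>UNIV. emeasure D (A i))"
      by (simp add: M_def)
  qed auto

  define R where "R = restrict_space borel (orthogonal_group :: (real^'n::_^'n::_) set)"
  have space_R: "space R = orthogonal_group" by (simp add: R_def space_restrict_space)
  define h where "h v = (if v \<in> E then transpose (\<chi> j. gram_schmidt_col v j) else mat 1)"
    for v :: "'n \<Rightarrow> real^'n::_"
  have h_orth: "orthogonal_matrix (h v)" for v
  proof (cases "v \<in> E")
    case True
    then have det: "det (\<chi> i. v i) \<noteq> 0" by (simp add: E_def)
    have "orthogonal_matrix (\<chi> j. gram_schmidt_col v j)"
      unfolding orthogonal_matrix_orthonormal_rows
    proof (intro conjI allI impI)
      fix i j :: 'n
      show "norm (row i (\<chi> j. gram_schmidt_col v j)) = 1"
        using gram_schmidt_col_orthonormal[OF det, of i] by (simp add: row_def)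
      assume "i \<noteq> j"
      then show "orthogonal (row i (\<chi> j. gram_schmidt_col v j)) (row j (\<chi> j. gram_schmidt_col v j))"
        using gram_schmidt_col_orthonormal[OF det, of i] gram_schmidt_col_orthonormal[OF det, of j]
        by (cases i j rule: linorder_cases) (auto simp: row_def orthogonal_def inner_commute)
    qed
    then show ?thesis using True by (simp add: h_def)
  qed (simp add: h_def orthogonal_matrix_id)
  have h_equiv: "h (\<lambda>j. Q *v v j) = Q ** h v \<and> (\<lambda>j. Q *v v j) \<in> E"
    if Q: "orthogonal_matrix Q" and v: "v \<in> E" for Q :: "real^'n::_^'n::_" and v
  proof -
    have "(\<chi> i. Q *v v i) = (\<chi> i. v i) ** transpose Q"
      by (simp add: vec_eq_iff matrix_matrix_mult_def matrix_vector_mult_def transpose_def mult.commute)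
    then have "det (\<chi> i. Q *v v i) = det (\<chi> i. v i) * det Q"
      by (simp add: det_mul)
    moreover have "det Q \<noteq> 0" using det_orthogonal_matrix[OF Q] by auto
    ultimately have "(\<lambda>j. Q *v v j) \<in> E" using v by (simp add: E_def)
    moreover have "transpose (\<chi> j. Q *v gram_schmidt_col v j) = Q ** transpose (\<chi> j. gram_schmidt_col v j)"
      by (simp add: vec_eq_iff matrix_matrix_mult_def matrix_vector_mult_def transpose_def)
    moreover have "gram_schmidt_col (\<lambda>j. Q *v v j) = (\<lambda>j. Q *v gram_schmidt_col v j)"
      using gram_schmidt_col_equivariant[OF Q] by (rule ext)
    ultimately show ?thesis
      using v by (simp add: h_def)
  qed
  have h_meas: "h \<in> measurable M R"
  proof -
    have [measurable]: "(\<lambda>v. gram_schmidt_col v j) \<in> borel_measurable M" for j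
      unfolding measurable_cong_sets[OF sets_M refl] by (rule gram_schmidt_col_measurable)
    have [measurable]: "(\<lambda>v. gram_schmidt_col v j $ i) \<in> borel_measurable M" for i j
      by (simp add: cart_eq_inner_axis)
    have "(\<lambda>v. transpose (\<chi> j. gram_schmidt_col v j)) \<in> borel_measurable M"
      unfolding transpose_def
      by (subst borel_measurable_euclidean_space)
        (auto simp: Basis_vec_def inner_axis)
    then have "h \<in> borel_measurable M"
      unfolding h_def by measurable
    then show ?thesis
      unfolding R_def using h_orth by (intro measurable_restrict_space2) (auto simp: orthogonal_group_def)
  qed

  define U where "U = uniform_measure M E"
  interpret U: prob_space U
    unfolding U_def by (rule prob_space_uniform_measure[OF E_pos]) simp
  have sets_U [simp]: "sets U = sets M" and space_U [simp]: "space U = UNIV"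
    by (simp_all add: U_def)
  have h_meas_U: "h \<in> measurable U R" using h_meas by (simp add: measurable_cong_sets[OF sets_U refl])
  define \<nu> where "\<nu> = distr U R h"
  have sets_\<nu>: "sets \<nu> = sets R" and space_\<nu>: "space \<nu> = orthogonal_group"
    by (simp_all add: \<nu>_def space_R)
  have em: "emeasure \<nu> X = emeasure M (E \<inter> h -` X) / emeasure M E" if X: "X \<in> sets R" for X
  proof -
    have "h -` X \<in> sets M" using measurable_sets[OF h_meas X] by simp
    then show ?thesis
      using X h_meas_U by (simp add: \<nu>_def emeasure_distr U_def)
  qed
  have "distr \<nu> \<nu> (\<lambda>H. Q ** H) = \<nu>" if Q: "Q \<in> orthogonal_group" for Q
  proof (rule measure_eqI)
    have Q': "orthogonal_matrix Q" using Q by (simp add: orthogonal_group_def)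
    have "(\<lambda>H. Q ** H) \<in> borel_measurable borel"
      by (intro borel_measurable_continuous_onI linear_continuous_on linear_linear[THEN iffD2])
        (auto intro!: linearI simp: vec_eq_iff matrix_matrix_mult_def sum.distrib distrib_left
          sum_distrib_left mult.left_commute)
    then have meas: "(\<lambda>H. Q ** H) \<in> measurable \<nu> \<nu>"
      unfolding measurable_cong_sets[OF sets_\<nu> sets_\<nu>] R_def
      using Q' by (intro measurable_restrict_space3) (auto simp: orthogonal_group_def orthogonal_matrix_mul)
    fix X assume "X \<in> sets (distr \<nu> \<nu> (\<lambda>H. Q ** H))"
    then have X: "X \<in> sets R" by (simp add: sets_\<nu>)
    define Y where "Y = (\<lambda>H. Q ** H) -` X \<inter> orthogonal_group"
    have Y: "Y \<in> sets R"
      using measurable_sets[OF meas, of X] X by (simp add: Y_def sets_\<nu> space_\<nu>)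
    have EX: "E \<inter> h -` X \<in> sets M" using measurable_sets[OF h_meas X] by simp
    have E_back: "v \<in> E" if "(\<lambda>j. Q *v v j) \<in> E" for v
    proof -
      have "orthogonal_matrix (transpose Q)" using Q' by simp
      from h_equiv[OF this that] Q' show ?thesis
        by (simp add: matrix_vector_mul_assoc orthogonal_matrix_def del: transpose_matrix_vector)
    qed
    have "E \<inter> h -` Y = (\<lambda>v j. Q *v v j) -` (E \<inter> h -` X)"
    proof (rule set_eqI)
      fix v
      show "v \<in> E \<inter> h -` Y \<longleftrightarrow> v \<in> (\<lambda>v j. Q *v v j) -` (E \<inter> h -` X)"
        using h_equiv[OF Q', of v] E_back[of v] h_orth[of v]
        by (cases "v \<in> E"; cases "(\<lambda>j. Q *v v j) \<in> E") (simp_all add: Y_def orthogonal_group_def)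
    qed
    then have "emeasure M (E \<inter> h -` Y) = emeasure (distr M M (\<lambda>v j. Q *v v j)) (E \<inter> h -` X)"
      using EX T_meas by (simp add: emeasure_distr)
    then have "emeasure M (E \<inter> h -` Y) = emeasure M (E \<inter> h -` X)"
      by (simp add: M_inv[OF Q'])
    then have "emeasure \<nu> Y = emeasure \<nu> X" by (simp add: em X Y)
    then show "emeasure (distr \<nu> \<nu> (\<lambda>H. Q ** H)) X = emeasure \<nu> X"
      using X meas by (simp add: emeasure_distr sets_\<nu> space_\<nu> Y_def)
  qed simp
  moreover have "prob_space \<nu>"
    unfolding \<nu>_def by (rule U.prob_space_distr[OF h_meas_U])
  ultimately have "normalized_haar \<nu>"
    unfolding normalized_haar_def using sets_\<nu> by (simp add: R_def)
  then show ?thesis ..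
qed

lemma normalized_haar_haar_orthogonal:
  "normalized_haar (haar_orthogonal :: (real^'n::{finite,wellorder}^'n::_) measure)"
  unfolding haar_orthogonal_def by (rule someI_ex[OF normalized_haar_exists])

definition is_partition :: "(nat \<Rightarrow> nat) \<Rightarrow> bool" where
  "is_partition \<kappa> \<longleftrightarrow> antimono \<kappa> \<and> finite {j. \<kappa> j \<noteq> 0}"

definition part_length :: "(nat \<Rightarrow> nat) \<Rightarrow> nat" where
  "part_length \<kappa> = card {j. \<kappa> j \<noteq> 0}"

definition part_weight :: "(nat \<Rightarrow> nat) \<Rightarrow> nat" where
  "part_weight \<kappa> = (\<Sum>j | \<kappa> j \<noteq> 0. \<kappa> j)"

definition partitions :: "nat \<Rightarrow> nat \<Rightarrow> (nat \<Rightarrow> nat) set" where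
  "partitions k n = {\<kappa>. is_partition \<kappa> \<and> part_weight \<kappa> = k \<and> part_length \<kappa> \<le> n}"

lemma is_partition_nonzero_iff:
  assumes "is_partition \<kappa>"
  shows "\<kappa> j \<noteq> 0 \<longleftrightarrow> j < part_length \<kappa>"
proof -
  let ?A = "{j. \<kappa> j \<noteq> 0}"
  have fin: "finite ?A" using assms by (simp add: is_partition_def)
  have down: "\<kappa> j \<le> \<kappa> i" if "i \<le> j" for i j
    using assms that unfolding is_partition_def by (blast dest: antimonoD)
  have "{..<part_length \<kappa>} = ?A"
  proof (rule ccontr)
    assume ne: "{..<part_length \<kappa>} \<noteq> ?A"
    have "card {..<part_length \<kappa>} = card ?A" by (simp add: part_length_def)
    then have "\<not> ?A \<subseteq> {..<part_length \<kappa>}" using ne card_subset_eq[of "{..<part_length \<kappa>}" ?A] by auto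
    then obtain j where j: "\<kappa> j \<noteq> 0" "part_length \<kappa> \<le> j" by (metis (mono_tags, lifting) lessThan_iff mem_Collect_eq not_less subsetI)
    have "\<kappa> i \<noteq> 0" if "i \<le> j" for i using down[OF that] j by linarith
    then have "{..j} \<subseteq> ?A" by auto
    then have "card {..j} \<le> part_length \<kappa>" unfolding part_length_def using fin by (intro card_mono) auto
    then show False using j by simp
  qed
  then show ?thesis by auto
qed

lemma finite_partitions: "finite (partitions k n)"
proof (rule finite_subset)
  show "partitions k n \<subseteq> {f. \<forall>x. (x \<in> {..<n} \<longrightarrow> f x \<in> {..k}) \<and> (x \<notin> {..<n} \<longrightarrow> f x = 0)}"
  proof (clarsimp simp: partitions_def, intro conjI allI impI)
    fix \<kappa> x assume p: "is_partition \<kappa>" "part_length \<kappa> \<le> n"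
    show "\<kappa> x \<le> part_weight \<kappa>"
      using p by (cases "\<kappa> x = 0") (auto simp: part_weight_def is_partition_def intro!: member_le_sum)
    assume "\<not> x < n"
    then show "\<kappa> x = 0" using is_partition_nonzero_iff[OF p(1), of x] p(2) by auto
  qed
  show "finite {f. \<forall>x. (x \<in> {..<n} \<longrightarrow> f x \<in> {..k}) \<and> (x \<notin> {..<n} \<longrightarrow> f x = (0::nat))}"
    by (rule finite_set_of_finite_funs) auto
qed

text \<open>The factors beyond the length of the partition are empty products.\<close>

definition partitional_pochhammer :: "real \<Rightarrow> (nat \<Rightarrow> nat) \<Rightarrow> real" where
  "partitional_pochhammer a \<kappa> = (\<Prod>i<part_length \<kappa>. pochhammer (a - real i / 2) (\<kappa> i))"

definition leading_indices :: "nat \<Rightarrow> 'n::{finite,wellorder} set" where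
  "leading_indices j = {i. card {..<i} < j}"

text \<open>
  The Leibniz formula of \<open>det_def\<close>, restricted to the first \<open>j\<close> rows and columns.
\<close>

definition leading_minor :: "nat \<Rightarrow> real^'n::{finite,wellorder}^'n::_ \<Rightarrow> real" where
  "leading_minor j S =
     (\<Sum>\<pi> | \<pi> permutes leading_indices j.
        of_int (sign \<pi>) * (\<Prod>i\<in>leading_indices j. S $ i $ \<pi> i))"

lemma leading_minor_full:
  "leading_minor CARD('n) (S :: real^'n::{finite,wellorder}^'n::_) = det S"
proof -
  have "card {..<i} < CARD('n)" for i :: 'n
    by (rule psubset_card_mono) auto
  then have "leading_indices CARD('n) = (UNIV :: 'n set)"
    by (auto simp: leading_indices_def)
  then show ?thesis by (simp add: leading_minor_def det_def)
qed

text \<open>\<open>zonal_identity n \<kappa>\<close> is \<open>C\<^sub>\<kappa>(I\<^sub>n)\<close>, \<open>zonal \<kappa> S\<close> is \<open>C\<^sub>\<kappa>(S)\<close>.\<close>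

definition zonal_identity :: "nat \<Rightarrow> (nat \<Rightarrow> nat) \<Rightarrow> real" where
  "zonal_identity n \<kappa> =
     (let l = part_length \<kappa> in
       2 ^ (2 * part_weight \<kappa>) * fact (part_weight \<kappa>) * partitional_pochhammer (real n / 2) \<kappa> *
       (\<Prod>(i, j) \<in> {(i, j). i < j \<and> j < l}. 2 * real (\<kappa> i) - 2 * real (\<kappa> j) - real i + real j) /
       (\<Prod>i<l. fact (2 * \<kappa> i + l - (i + 1))))"

definition zonal :: "(nat \<Rightarrow> nat) \<Rightarrow> real^'n::{finite,wellorder}^'n::_ \<Rightarrow> real" where
  "zonal \<kappa> S =
     zonal_identity CARD('n) \<kappa> *
     (\<integral>H. (\<Prod>j = 1..part_length \<kappa>.
             leading_minor j (transpose H ** S ** H) ^ (\<kappa> (j - 1) - \<kappa> j)) \<partial>haar_orthogonal)"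

text \<open>The normalizing constant itself is the case \<open>m = 0\<close>.\<close>

definition langevin_remainder :: "nat \<Rightarrow> real^'p::{finite,wellorder}^'d::finite \<Rightarrow> real" where
  "langevin_remainder m B =
     (\<Sum>i. let k = m + i in
       1 / fact k *
       (\<Sum>\<kappa>\<in>partitions k CARD('p).
          zonal \<kappa> ((1 / 4) *\<^sub>R (transpose B ** B)) / partitional_pochhammer (real CARD('d) / 2) \<kappa>))"

text \<open>
  \<open>\<beta> 1 \<ge> \<dots> \<ge> \<beta> n\<close> are the roots of the characteristic polynomial of \<open>S\<close>, with multiplicity;
  \<open>mat x\<close> is \<open>x\<close> times the identity matrix.
\<close>

definition ordered_eigenvalues :: "real^'n^'n \<Rightarrow> (nat \<Rightarrow> real) \<Rightarrow> bool" where
  "ordered_eigenvalues S \<beta> \<longleftrightarrow>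
     (\<forall>i j. 1 \<le> i \<and> i \<le> j \<and> j \<le> CARD('n) \<longrightarrow> \<beta> j \<le> \<beta> i) \<and>
     (\<forall>x. det (mat x - S) = (\<Prod>i = 1..CARD('n). x - \<beta> i))"

definition hypergeometric_1F2 :: "real \<Rightarrow> real \<Rightarrow> real \<Rightarrow> real \<Rightarrow> real" where
  "hypergeometric_1F2 a b c z =
     (\<Sum>k. pochhammer a k / (pochhammer b k * pochhammer c k) * z ^ k / fact k)"

end

theory Submission
  imports Defs
begin

text \<open>
  Let \<open>b\<close> be the least eigenvalue of \<open>S = B'B / 4\<close>. As \<open>H'SH - b I\<close> is positive semidefinite, the leading
  \<open>j \<times> j\<close> minor of \<open>H'SH\<close> is at least \<open>b\<^sup>j\<close>, so \<open>C\<^sub>\<kappa>(S) \<ge> C\<^sub>\<kappa>(I) b\<^sup>k\<close> for \<open>|\<kappa>| = k\<close>; in particular all terms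
  of the series are nonnegative, and for each \<open>k\<close> a single \<open>\<kappa>\<close> suffices. By the duplication formula for
  shifted factorials, \<open>C\<^sub>\<kappa>(I)\<close> is at least the multinomial coefficient \<open>k! / \<Prod>\<kappa>\<^sub>i!\<close> up to a factor
  \<open>(1 + k)\<close> to the power \<open>p (p - 1) / 2\<close>, and for the partition of \<open>k\<close> into \<open>p\<close> nearly equal parts this
  coefficient is at least \<open>p\<^sup>k\<close> up to a factor \<open>(1 + k)\<close> to the power \<open>p - 1\<close>; the exponents add up to \<open>N\<close>.
  By the inequality of arithmetic and geometric means, \<open>(d/2)\<^sub>\<kappa> \<le> ((d + k) / 2)\<^sup>k\<close>. The resulting bound
  on the \<open>k\<close>-th term dominates the term of index \<open>k - m\<close> of the hypergeometric series, since
  \<open>(x + 1)\<^sup>k \<le> e x\<^sup>k\<close> for \<open>x \<ge> k\<close>.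
\<close>

section \<open>Minors and eigenvalues\<close>

text \<open>Along the segment from \<open>P\<close> to the identity the quadratic form is positive
  definite for every \<open>t > 0\<close>, so the determinant has no zero there. By continuity a
  negative \<open>det P\<close> could not reach \<open>det (mat 1) = 1\<close>.\<close>

lemma det_nonneg_if_quadratic_form_nonneg:
  fixes P :: "real^'n^'n"
  assumes "\<And>x. 0 \<le> x \<bullet> (P *v x)"
  shows "0 \<le> det P"
proof (rule ccontr)
  assume neg: "\<not> 0 \<le> det P"
  define h where "h t = det (t *\<^sub>R mat 1 + (1 - t) *\<^sub>R P)" for t :: real
  have "continuous_on {0..1} h"
    unfolding h_def det_def by (intro continuous_intros)
  moreover have "h 0 \<le> 0" "0 \<le> h 1"
    using neg by (simp_all add: h_def det_I)
  ultimately obtain t where t: "0 \<le> t" "t \<le> 1" "h t = 0"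
    using IVT'[of h 0 0 1] by auto
  have "t \<noteq> 0" using t neg by (auto simp: h_def)
  then have "0 < t" using t by simp
  obtain x where x: "x \<noteq> 0" "(t *\<^sub>R mat 1 + (1 - t) *\<^sub>R P) *v x = 0"
    using t(3) unfolding h_def
    by (metis invertible_det_nz invertible_left_inverse matrix_left_invertible_ker)
  have "0 = x \<bullet> ((t *\<^sub>R mat 1 + (1 - t) *\<^sub>R P) *v x)" using x by simp
  also have "\<dots> = t * (x \<bullet> x) + (1 - t) * (x \<bullet> (P *v x))"
    by (simp add: matrix_vector_mult_add_rdistrib scaleR_matrix_vector_assoc[symmetric] inner_add_right)
  also have "\<dots> > 0"
    using x \<open>0 < t\<close> t assms[of x] by (intro add_pos_nonneg mult_pos_pos mult_nonneg_nonneg) auto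
  finally show False by simp
qed

text \<open>Padding the block on \<open>J\<close> with the identity keeps the index type fixed, so
  the minor on \<open>J\<close> is the determinant of a matrix of full size.\<close>

definition principal_block :: "'n set \<Rightarrow> real^'n^'n \<Rightarrow> real^'n^'n" where
  "principal_block J A =
     (\<chi> i k. if i \<in> J \<and> k \<in> J then A $ i $ k else if i = k then 1 else 0)"

lemma principal_block_quadratic_form:
  fixes A :: "real^'n^'n"
  shows "x \<bullet> (principal_block J A *v x) =
    (\<chi> k. if k \<in> J then x $ k else 0) \<bullet> (A *v (\<chi> k. if k \<in> J then x $ k else 0)) +
    (\<Sum>k | k \<notin> J. x $ k * x $ k)"
proof -
  let ?y = "\<chi> k. if k \<in> J then x $ k else 0"
  have *: "(principal_block J A *v x) $ i = (if i \<in> J then (A *v ?y) $ i else x $ i)" for i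
  proof (cases "i \<in> J")
    case True
    then show ?thesis
      by (auto simp: principal_block_def matrix_vector_mult_def intro!: sum.cong)
  next
    case False
    have "(\<Sum>k\<in>UNIV. (if i = k then 1 else 0) * x $ k) = (\<Sum>k\<in>UNIV. if i = k then x $ k else 0)"
      by (rule sum.cong) auto
    with False show ?thesis
      by (simp add: principal_block_def matrix_vector_mult_def)
  qed
  have "x \<bullet> (principal_block J A *v x) =
      (\<Sum>i\<in>UNIV. ?y $ i * (A *v ?y) $ i + (if i \<notin> J then x $ i * x $ i else 0))"
    unfolding inner_vec_def by (rule sum.cong) (auto simp: *)
  also have "\<dots> = ?y \<bullet> (A *v ?y) + (\<Sum>k | k \<notin> J. x $ k * x $ k)"
    by (simp add: sum.distrib inner_vec_def sum.If_cases)
  finally show ?thesis .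
qed

text \<open>A determinant is affine in one diagonal entry: row \<open>i\<close> is the row of the
  shifted matrix plus \<open>b\<close> times a unit vector, and the cofactor of that entry is the
  minor on \<open>J\<close>.\<close>

lemma det_principal_block_insert:
  fixes A :: "real^'n^'n"
  assumes "i \<notin> J"
  shows "det (principal_block (insert i J) A) =
    det (principal_block (insert i J) (\<chi> k l. A $ k $ l - (if k = i \<and> l = i then b else 0))) +
    b * det (principal_block J A)"
proof -
  let ?M = "principal_block (insert i J) A"
  let ?M' = "principal_block (insert i J) (\<chi> k l. A $ k $ l - (if k = i \<and> l = i then b else 0))"
  have "?M = (\<chi> k. if k = i then ?M' $ i + b *s axis i 1 else ?M $ k)"
    by (auto simp: vec_eq_iff principal_block_def axis_def)
  then have "det ?M = det (\<chi> k. if k = i then ?M' $ i + b *s axis i 1 else ?M $ k)"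
    by simp
  also have "\<dots> = det (\<chi> k. if k = i then ?M' $ i else ?M $ k) +
      b * det (\<chi> k. if k = i then axis i 1 else ?M $ k)"
    by (simp add: det_row_add det_row_mul)
  also have "(\<chi> k. if k = i then ?M' $ i else ?M $ k) = ?M'"
    by (auto simp: vec_eq_iff principal_block_def)
  \<comment> \<open>The Leibniz expansions agree term by term: a permutation fixing \<open>i\<close>
    sends no other row to column \<open>i\<close>, and one moving \<open>i\<close> picks a zero in
    row \<open>i\<close> on both sides.\<close>
  also have "det (\<chi> k. if k = i then axis i 1 else ?M $ k) = det (principal_block J A)"
    unfolding det_def
  proof (rule sum.cong[OF refl])
    fix \<pi> assume "\<pi> \<in> {\<pi>. \<pi> permutes (UNIV :: 'n set)}"
    then have \<pi>: "\<pi> permutes UNIV" by simp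
    let ?L = "(\<chi> k. if k = i then axis i 1 else ?M $ k) :: real^'n^'n"
    have "(\<Prod>k\<in>UNIV. ?L $ k $ \<pi> k) = (\<Prod>k\<in>UNIV. principal_block J A $ k $ \<pi> k)"
    proof (cases "\<pi> i = i")
      case True
      then have "\<pi> k = i \<longleftrightarrow> k = i" for k using permutes_inj[OF \<pi>] by (metis injD)
      with assms show ?thesis
        by (intro prod.cong) (auto simp: principal_block_def axis_def True)
    next
      case False
      then have "?L $ i $ \<pi> i = 0" "principal_block J A $ i $ \<pi> i = 0"
        using assms by (auto simp: principal_block_def axis_def)
      then have "(\<Prod>k\<in>UNIV. ?L $ k $ \<pi> k) = 0" "(\<Prod>k\<in>UNIV. principal_block J A $ k $ \<pi> k) = 0"
        by (simp_all only: prod_zero_iff finite) blast+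
      then show ?thesis by (simp only:)
    qed
    then show "of_int (sign \<pi>) * (\<Prod>k\<in>UNIV. ?L $ k $ \<pi> k) =
        of_int (sign \<pi>) * (\<Prod>k\<in>UNIV. principal_block J A $ k $ \<pi> k)" by simp
  qed
  finally show ?thesis .
qed

text \<open>Indices are added one at a time. Subtracting \<open>b\<close> from the single entry (i,
  i) costs at most \<open>b * (x \<bullet> x)\<close>, so the form stays nonnegative and so does the
  shifted minor; what remains is \<open>b\<close> times the minor on \<open>J\<close>.\<close>

lemma power_card_le_det_principal_block:
  fixes A :: "real^'n^'n"
  assumes A: "\<And>x. b * (x \<bullet> x) \<le> x \<bullet> (A *v x)" and "0 \<le> b"
  shows "b ^ card J \<le> det (principal_block J A)"
proof (induction J rule: infinite_finite_induct)
  case empty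
  have "principal_block {} A = mat 1"
    by (simp add: vec_eq_iff principal_block_def mat_def)
  then show ?case by (simp add: det_I)
next
  case (insert i J)
  let ?A' = "(\<chi> k l. A $ k $ l - (if k = i \<and> l = i then b else 0)) :: real^'n^'n"
  have A': "0 \<le> x \<bullet> (?A' *v x)" for x
  proof -
    have "?A' = A - (\<chi> k l. if k = i \<and> l = i then b else 0)"
      by (simp add: vec_eq_iff)
    moreover have "((\<chi> k l. if k = i \<and> l = i then b else 0) *v x) = (b * x $ i) *\<^sub>R axis i 1"
      by (auto simp: vec_eq_iff matrix_vector_mult_def axis_def if_distrib[of "\<lambda>u. u * _"] cong: if_cong)
    ultimately have "x \<bullet> (?A' *v x) = x \<bullet> (A *v x) - b * (x $ i * x $ i)"
      by (simp add: matrix_vector_mult_diff_rdistrib inner_diff_right inner_axis mult_ac)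
    moreover have "x $ i * x $ i \<le> x \<bullet> x"
      unfolding inner_vec_def by (simp, rule member_le_sum[of i UNIV "\<lambda>i. x $ i * x $ i"]) auto
    then have "b * (x $ i * x $ i) \<le> b * (x \<bullet> x)" using \<open>0 \<le> b\<close> by (rule mult_left_mono)
    ultimately show ?thesis using A[of x] by linarith
  qed
  have "0 \<le> det (principal_block (insert i J) ?A')"
    by (rule det_nonneg_if_quadratic_form_nonneg)
      (use A' in \<open>auto simp: principal_block_quadratic_form intro!: add_nonneg_nonneg sum_nonneg\<close>)
  moreover have "b * b ^ card J \<le> b * det (principal_block J A)"
    using insert.IH \<open>0 \<le> b\<close> by (rule mult_left_mono)
  ultimately show ?case
    using insert.hyps by (simp add: det_principal_block_insert[of i J A b])
qed auto

text \<open>A permutation that moves an index outside the block meets an off-diagonal zero of the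
  padding; the others are exactly those in the restricted Leibniz formula.\<close>

lemma leading_minor_eq_det_principal_block:
  fixes A :: "real^'n::{finite,wellorder}^'n::_"
  shows "leading_minor j A = det (principal_block (leading_indices j) A)"
proof -
  let ?L = "leading_indices j :: 'n set" and ?M = "principal_block (leading_indices j) A"
  have "det ?M = (\<Sum>\<pi> | \<pi> permutes ?L. of_int (sign \<pi>) * (\<Prod>i\<in>UNIV. ?M $ i $ \<pi> i))"
    unfolding det_def
  proof (rule sum.mono_neutral_right)
    show "\<forall>\<pi>\<in>{\<pi>. \<pi> permutes UNIV} - {\<pi>. \<pi> permutes ?L}.
        of_int (sign \<pi>) * (\<Prod>i\<in>UNIV. ?M $ i $ \<pi> i) = 0"
    proof
      fix \<pi> assume "\<pi> \<in> {\<pi>. \<pi> permutes UNIV} - {\<pi>. \<pi> permutes ?L}"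
      then obtain i where "i \<notin> ?L" "\<pi> i \<noteq> i"
        unfolding permutes_def by blast
      then have "?M $ i $ \<pi> i = 0" by (simp add: principal_block_def)
      then have "(\<Prod>i\<in>UNIV. ?M $ i $ \<pi> i) = 0"
        by (intro prod_zero) (blast intro: finite)+
      then show "of_int (sign \<pi>) * (\<Prod>i\<in>UNIV. ?M $ i $ \<pi> i) = 0" by simp
    qed
  qed (auto simp: finite_permutations intro: permutes_subset)
  also have "\<dots> = leading_minor j A"
    unfolding leading_minor_def
  proof (rule sum.cong[OF refl])
    fix \<pi> assume "\<pi> \<in> {\<pi>. \<pi> permutes ?L}"
    then have "\<pi> permutes ?L" by simp
    then have "i \<in> ?L \<longleftrightarrow> \<pi> i \<in> ?L" "i \<notin> ?L \<Longrightarrow> \<pi> i = i" for i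
      by (simp_all add: permutes_in_image permutes_not_in)
    then have "(\<Prod>i\<in>UNIV. ?M $ i $ \<pi> i) = (\<Prod>i\<in>UNIV. if i \<in> ?L then A $ i $ \<pi> i else 1)"
      by (intro prod.cong) (auto simp: principal_block_def)
    then show "of_int (sign \<pi>) * (\<Prod>i\<in>UNIV. ?M $ i $ \<pi> i) =
        of_int (sign \<pi>) * (\<Prod>i\<in>?L. A $ i $ \<pi> i)"
      by (simp add: prod.If_cases)
  qed
  finally show ?thesis ..
qed

text \<open>The rank of an index, \<open>card {..<i}\<close>, is strictly increasing and hence a
  bijection onto \<open>{..<CARD('n)}\<close>.\<close>

lemma card_leading_indices:
  assumes "j \<le> CARD('n::{finite,wellorder})"
  shows "card (leading_indices j :: 'n set) = j"
proof -
  let ?r = "\<lambda>i::'n. card {..<i}"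
  have mono: "?r i < ?r k" if "i < k" for i k
    using that by (intro psubset_card_mono) auto
  then have inj: "inj ?r"
    by (metis (mono_tags, lifting) injI less_irrefl linorder_neqE)
  have "?r ` UNIV \<subseteq> {..<CARD('n)}"
    by (auto intro!: psubset_card_mono)
  then have "?r ` UNIV = {..<CARD('n)}"
    by (intro card_subset_eq) (simp_all add: card_image[OF inj])
  then have "?r ` leading_indices j = {..<j}"
    using assms unfolding leading_indices_def
    by (auto simp: image_iff set_eq_iff) (metis order_less_le_trans)
  then show ?thesis
    using card_image[OF inj_on_subset[OF inj subset_UNIV], of "leading_indices j"] by simp
qed

lemma power_le_leading_minor:
  fixes A :: "real^'n::{finite,wellorder}^'n::_"
  assumes "\<And>x. b * (x \<bullet> x) \<le> x \<bullet> (A *v x)" "0 \<le> b" "j \<le> CARD('n)"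
  shows "b ^ j \<le> leading_minor j A"
  using power_card_le_det_principal_block[OF assms(1,2), of "leading_indices j"] assms(3)
  by (simp add: leading_minor_eq_det_principal_block card_leading_indices)

text \<open>The form attains its minimum \<open>c\<close> on the unit sphere at some
  \<open>v\<close>, and homogeneity extends the bound to all vectors. Minimality along the residual
  \<open>w = S *v v - c *\<^sub>R v\<close> forces \<open>w = 0\<close>.\<close>

lemma symmetric_matrix_least_eigenvalue:
  fixes S :: "real^'n^'n"
  assumes "transpose S = S"
  obtains v c where "v \<noteq> 0" "S *v v = c *\<^sub>R v" "\<And>x. c * (x \<bullet> x) \<le> x \<bullet> (S *v x)"
proof -
  have sym: "x \<bullet> (S *v y) = y \<bullet> (S *v x)" for x y
    by (metis assms dot_lmul_matrix inner_commute transpose_matrix_vector)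
  let ?q = "\<lambda>x::real^'n. x \<bullet> (S *v x)"
  have "continuous_on (sphere 0 1) ?q"
    by (intro continuous_intros matrix_vector_mult_linear_continuous_on)
  moreover have "sphere (0::real^'n) 1 \<noteq> {}" by simp
  ultimately obtain v where v: "norm v = 1" "\<And>x. norm x = 1 \<Longrightarrow> ?q v \<le> ?q x"
    using continuous_attains_inf[of "sphere (0::real^'n) 1" ?q] by auto
  define c where "c = ?q v"
  have c: "c * (x \<bullet> x) \<le> ?q x" for x
  proof (cases "x = 0")
    case False
    have "c \<le> ?q (x /\<^sub>R norm x)"
      unfolding c_def using False by (intro v(2)) simp
    also have "\<dots> = ?q x / (x \<bullet> x)"
      using False by (simp add: matrix_vector_mult_scaleR dot_square_norm power2_eq_square field_simps)
    finally show ?thesis using False by (simp add: field_simps)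
  qed simp
  define w where "w = S *v v - c *\<^sub>R v"
  \<comment> \<open>In the expansion at \<open>v + t *\<^sub>R w\<close> the constant term vanishes
    and the linear coefficient is twice the squared norm of the residual.\<close>
  have quad: "0 \<le> 2 * t * (w \<bullet> w) + t\<^sup>2 * (?q w - c * (w \<bullet> w))" for t
  proof -
    have "0 \<le> ?q (v + t *\<^sub>R w) - c * ((v + t *\<^sub>R w) \<bullet> (v + t *\<^sub>R w))"
      using c by simp
    also have "\<dots> = (?q v - c * (v \<bullet> v)) + 2 * t * (w \<bullet> (S *v v) - c * (w \<bullet> v)) + t\<^sup>2 * (?q w - c * (w \<bullet> w))"
      by (simp add: matrix_vector_right_distrib matrix_vector_mult_scaleR inner_add_left inner_add_right
          sym[of v w] inner_commute[of v w] power2_eq_square algebra_simps)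
    also have "w \<bullet> (S *v v) - c * (w \<bullet> v) = w \<bullet> w"
      by (simp add: w_def inner_diff_right)
    also have "?q v - c * (v \<bullet> v) = 0"
      using v(1) by (simp add: c_def dot_square_norm)
    finally show ?thesis by simp
  qed
  define r where "r = ?q w - c * (w \<bullet> w)"
  have r: "0 \<le> r" using c by (simp add: r_def)
  define W where "W = w \<bullet> w"
  \<comment> \<open>A small negative \<open>t\<close> makes the linear term win. The shift by 1 in
    the denominator covers \<open>r = 0\<close>.\<close>
  have "0 \<le> 2 * (- W / (r + 1)) * W + (- W / (r + 1))\<^sup>2 * r"
    using quad unfolding r_def W_def by blast
  also have "\<dots> = - (W\<^sup>2 * (r + 2)) / (r + 1)\<^sup>2"
    using r by (simp add: divide_simps) (simp add: power2_eq_square algebra_simps)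
  finally have "W\<^sup>2 * (r + 2) \<le> 0"
    using r by (simp add: divide_le_0_iff)
  then have "W = 0"
    using r by (simp add: mult_le_0_iff)
  show thesis
  proof
    show "v \<noteq> 0" using v by auto
    show "S *v v = c *\<^sub>R v" using \<open>W = 0\<close> by (simp add: W_def w_def)
  qed (rule c)
qed

section \<open>Zonal polynomials at the identity\<close>

lemma sum_partition:
  assumes "\<kappa> \<in> partitions k n"
  shows "(\<Sum>i<part_length \<kappa>. \<kappa> i) = k"
proof -
  have "{j. \<kappa> j \<noteq> 0} = {..<part_length \<kappa>}"
    using assms is_partition_nonzero_iff[of \<kappa>] by (auto simp: partitions_def)
  then show ?thesis using assms by (simp add: partitions_def part_weight_def)
qed

lemma partition_antimono:
  assumes "\<kappa> \<in> partitions k n" "i \<le> j"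
  shows "\<kappa> j \<le> \<kappa> i"
  using assms unfolding partitions_def is_partition_def by (blast dest: antimonoD)

text \<open>A partition is determined by its first \<open>n\<close> parts, each at most
  \<open>k\<close>. This crude count is enough for convergence.\<close>

lemma card_partitions_le: "card (partitions k n) \<le> (k + 1) ^ n"
proof -
  let ?F = "\<lambda>\<kappa>. \<lambda>i\<in>{..<n}. \<kappa> i"
  have zero: "\<kappa> i = 0" if "\<kappa> \<in> partitions k n" "n \<le> i" for \<kappa> i
    using that is_partition_nonzero_iff[of \<kappa> i] by (force simp: partitions_def)
  have "inj_on ?F (partitions k n)"
  proof (rule inj_onI, rule ext)
    fix \<kappa> \<kappa>' i assume *: "\<kappa> \<in> partitions k n" "\<kappa>' \<in> partitions k n" "?F \<kappa> = ?F \<kappa>'"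
    show "\<kappa> i = \<kappa>' i"
    proof (cases "i < n")
      case True
      then show ?thesis using fun_cong[OF *(3), of i] by simp
    next
      case False
      then show ?thesis using zero[OF *(1)] zero[OF *(2)] by simp
    qed
  qed
  moreover have "?F ` partitions k n \<subseteq> {..<n} \<rightarrow>\<^sub>E {..k}"
  proof (clarsimp simp: PiE_iff)
    fix \<kappa> i assume \<kappa>: "\<kappa> \<in> partitions k n"
    show "\<kappa> i \<le> k"
    proof (cases "i < part_length \<kappa>")
      case True
      then have "\<kappa> i \<le> (\<Sum>i<part_length \<kappa>. \<kappa> i)" by (intro member_le_sum) auto
      then show ?thesis by (simp add: sum_partition[OF \<kappa>])
    next
      case False
      then show ?thesis using is_partition_nonzero_iff[of \<kappa> i] \<kappa> by (auto simp: partitions_def)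
    qed
  qed
  ultimately have "card (partitions k n) \<le> card ({..<n} \<rightarrow>\<^sub>E {..k})"
    by (intro card_inj_on_le) (auto intro: finite_PiE)
  then show ?thesis by (simp add: card_PiE)
qed

text \<open>This is the integrand of \<open>zonal\<close> with the \<open>j\<close>-th minor
  replaced by its value at \<open>b\<close> times the identity. Abel summation turns the total
  exponent into the weight.\<close>

lemma prod_power_partition:
  fixes b :: real
  assumes "\<kappa> \<in> partitions k n"
  shows "(\<Prod>j = 1..part_length \<kappa>. (b ^ j) ^ (\<kappa> (j - 1) - \<kappa> j)) = b ^ k"
proof -
  \<comment> \<open>The boundary term \<open>l * \<kappa> l\<close> vanishes at
    \<open>l = part_length \<kappa>\<close>. Truncated subtraction is exact because the parts
    decrease.\<close>
  have "(\<Sum>j = 1..l. j * (\<kappa> (j - 1) - \<kappa> j)) + l * \<kappa> l = (\<Sum>i<l. \<kappa> i)" for l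
  proof (induction l)
    case (Suc l)
    have "Suc l * (\<kappa> l - \<kappa> (Suc l)) + Suc l * \<kappa> (Suc l) = Suc l * \<kappa> l"
      using partition_antimono[OF assms, of l "Suc l"] by (simp flip: distrib_left)
    with Suc show ?case by simp
  qed simp
  from this[of "part_length \<kappa>"]
  have "(\<Sum>j = 1..part_length \<kappa>. j * (\<kappa> (j - 1) - \<kappa> j)) = k"
    using is_partition_nonzero_iff[of \<kappa> "part_length \<kappa>"] assms
    by (auto simp: sum_partition partitions_def)
  then show ?thesis
    by (simp flip: power_mult power_sum)
qed

section \<open>The difference product and shifted factorials\<close>

lemma pochhammer_nat_Suc: "pochhammer (real c + 1) n = fact (c + n) / fact c"
  using pochhammer_product'[of "1::real" c n] by (simp add: pochhammer_fact[symmetric] add.commute)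

lemma prod_pairs:
  fixes f :: "nat \<Rightarrow> nat \<Rightarrow> 'a :: comm_monoid_mult"
  shows "(\<Prod>(i, j) \<in> {(i, j). i < j \<and> j < l}. f i j) = (\<Prod>i<l. \<Prod>s = 1..l - 1 - i. f i (i + s))"
proof -
  have "(\<Prod>(i, j) \<in> {(i, j). i < j \<and> j < l}. f i j) = (\<Prod>(i, j) \<in> Sigma {..<l} (\<lambda>i. {i + 1..l - 1}). f i j)"
    by (rule prod.cong) auto
  also have "\<dots> = (\<Prod>i<l. \<Prod>j = i + 1..l - 1. f i j)"
    by (simp add: prod.Sigma)
  also have "\<dots> = (\<Prod>i<l. \<Prod>s = 1..l - 1 - i. f i (i + s))"
  proof (rule prod.cong[OF refl])
    fix i assume "i \<in> {..<l}"
    then show "(\<Prod>j = i + 1..l - 1. f i j) = (\<Prod>s = 1..l - 1 - i. f i (i + s))"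
      by (intro prod.reindex_bij_witness[of _ "\<lambda>s. i + s" "\<lambda>j. j - i"]) auto
  qed
  finally show ?thesis .
qed

text \<open>With \<open>s = j - i\<close>, each factor lies between \<open>s\<close>, as the parts
  decrease, and \<open>2 * \<kappa> i + s\<close>, as \<open>\<kappa> j \<ge> 0\<close>. Multiplying
  over \<open>s\<close> for fixed \<open>i\<close> gives a factorial and a quotient of
  factorials.\<close>

lemma partition_difference_product_bounds:
  assumes \<kappa>: "\<kappa> \<in> partitions k n" and l: "l = part_length \<kappa>"
  defines "D \<equiv> (\<Prod>(i, j) \<in> {(i, j). i < j \<and> j < l}. 2 * real (\<kappa> i) - 2 * real (\<kappa> j) - real i + real j)"
  shows "(\<Prod>i<l. fact (l - 1 - i)) \<le> D"
    and "D \<le> (\<Prod>i<l. fact (2 * \<kappa> i + l - (i + 1)) / fact (2 * \<kappa> i))"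
proof -
  have D: "D = (\<Prod>i<l. \<Prod>s = 1..l - 1 - i. 2 * real (\<kappa> i) - 2 * real (\<kappa> (i + s)) - real i + real (i + s))"
    unfolding D_def by (rule prod_pairs)
  have anti: "real s \<le> 2 * real (\<kappa> i) - 2 * real (\<kappa> (i + s)) - real i + real (i + s)" for i s
    using partition_antimono[OF \<kappa>, of i "i + s"] by simp
  then have nonneg: "0 \<le> 2 * real (\<kappa> i) - 2 * real (\<kappa> (i + s)) - real i + real (i + s)" for i s
    using order_trans[OF of_nat_0_le_iff] by blast
  have "(\<Prod>i<l. fact (l - 1 - i)) = (\<Prod>i<l. \<Prod>s = 1..l - 1 - i. real s)"
    by (simp add: fact_prod)
  also have "\<dots> \<le> D"
    unfolding D by (intro prod_mono conjI prod_nonneg anti) auto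
  finally show "(\<Prod>i<l. fact (l - 1 - i)) \<le> D" .
  have "D \<le> (\<Prod>i<l. \<Prod>s = 1..l - 1 - i. real (2 * \<kappa> i + s))"
    unfolding D by (intro prod_mono conjI prod_nonneg nonneg) auto
  also have "\<dots> = (\<Prod>i<l. fact (2 * \<kappa> i + l - (i + 1)) / fact (2 * \<kappa> i))"
  proof (rule prod.cong[OF refl])
    fix i assume "i \<in> {..<l}"
    have "(\<Prod>s = 1..r. real (c + s)) = pochhammer (real c + 1) r" for c r
      by (induction r) (auto simp: pochhammer_Suc algebra_simps)
    from this[where c = "2 * \<kappa> i" and r = "l - 1 - i"]
    show "(\<Prod>s = 1..l - 1 - i. real (2 * \<kappa> i + s)) = fact (2 * \<kappa> i + l - (i + 1)) / fact (2 * \<kappa> i)"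
      using \<open>i \<in> {..<l}\<close> pochhammer_nat_Suc[of "2 * \<kappa> i" "l - 1 - i"] by (simp add: add.commute)
  qed
  finally show "D \<le> (\<Prod>i<l. fact (2 * \<kappa> i + l - (i + 1)) / fact (2 * \<kappa> i))" .
qed

lemma partitional_pochhammer_pos:
  assumes "\<kappa> \<in> partitions k n" "n \<le> d"
  shows "0 < partitional_pochhammer (real d / 2) \<kappa>"
  unfolding partitional_pochhammer_def
  using assms by (intro prod_pos ballI pochhammer_pos) (auto simp: partitions_def)

lemma zonal_identity_nonneg:
  assumes \<kappa>: "\<kappa> \<in> partitions k n"
  shows "0 \<le> zonal_identity n \<kappa>"
proof -
  have "0 \<le> (\<Prod>i<part_length \<kappa>. fact (part_length \<kappa> - 1 - i) :: real)"
    by (intro prod_nonneg) auto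
  also note partition_difference_product_bounds(1)[OF \<kappa> refl]
  finally have D: "0 \<le> (\<Prod>(i, j) \<in> {(i, j). i < j \<and> j < part_length \<kappa>}.
      2 * real (\<kappa> i) - 2 * real (\<kappa> j) - real i + real j)" .
  show ?thesis
    unfolding zonal_identity_def Let_def
    by (intro divide_nonneg_nonneg mult_nonneg_nonneg D
        less_imp_le[OF partitional_pochhammer_pos[OF \<kappa> order_refl]]) (auto intro: prod_nonneg)
qed

text \<open>The upper bound for the difference product cancels the extra factors in the denominator.
  It is used only for convergence.\<close>

lemma zonal_identity_le:
  assumes \<kappa>: "\<kappa> \<in> partitions k n"
  shows "zonal_identity n \<kappa> \<le>
    4 ^ k * fact k * partitional_pochhammer (real n / 2) \<kappa> / (\<Prod>i<part_length \<kappa>. fact (2 * \<kappa> i))"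
proof -
  let ?l = "part_length \<kappa>"
  let ?D = "(\<Prod>(i, j) \<in> {(i, j). i < j \<and> j < ?l}. 2 * real (\<kappa> i) - 2 * real (\<kappa> j) - real i + real j)"
  let ?F = "(\<Prod>i<?l. fact (2 * \<kappa> i + ?l - (i + 1))) :: real"
  have F: "0 < ?F" by (intro prod_pos) auto
  have "?D / ?F \<le> 1 / (\<Prod>i<?l. fact (2 * \<kappa> i))"
    using partition_difference_product_bounds(2)[OF \<kappa> refl] F
    by (simp add: prod_dividef divide_le_eq)
  then have "4 ^ k * fact k * partitional_pochhammer (real n / 2) \<kappa> * (?D / ?F) \<le>
      4 ^ k * fact k * partitional_pochhammer (real n / 2) \<kappa> * (1 / (\<Prod>i<?l. fact (2 * \<kappa> i)))"
    using partitional_pochhammer_pos[OF \<kappa> order_refl] by (intro mult_left_mono) auto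
  then show ?thesis
    using \<kappa> by (simp add: zonal_identity_def Let_def partitions_def power_mult)
qed

text \<open>Raising \<open>c\<close> by 1 multiplies \<open>pochhammer (real c + 1) n\<close> by (c
  + 1 + n) / (c + 1), which is at most 1 + n; the argument c/2 + 1 is then compared with c + 1. This
  is the source of the polynomial loss in \<open>zonal_identity_ge\<close>.\<close>

lemma pochhammer_half_le:
  "pochhammer (real c / 2 + 1) n \<le> fact n * (1 + real n) ^ c"
proof -
  have "pochhammer (real c + 1) n \<le> fact n * (1 + real n) ^ c"
  proof (induction c)
    case (Suc c)
    have "pochhammer (real (Suc c) + 1) n = pochhammer (real c + 1) n * ((real c + 1 + real n) / (real c + 1))"
      unfolding pochhammer_nat_Suc by (simp add: field_simps)
    also have "\<dots> \<le> (fact n * (1 + real n) ^ c) * (1 + real n)"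
      using Suc by (intro mult_mono) (auto simp: field_simps)
    finally show ?case by (simp add: mult_ac)
  qed (simp add: pochhammer_fact)
  moreover have "pochhammer (real c / 2 + 1) n \<le> pochhammer (real c + 1) n"
    unfolding pochhammer_prod by (intro prod_mono) auto
  ultimately show ?thesis by linarith
qed

text \<open>Pairing the factors of index \<open>i\<close> and \<open>n - 1 - i\<close>, whose mean
  is a + (n - 1)/2, bounds each product by the square of that mean.\<close>

lemma pochhammer_le_power:
  fixes a :: real
  assumes "0 \<le> a"
  shows "pochhammer a n \<le> (a + (real n - 1) / 2) ^ n"
proof (cases "n = 0")
  case False
  then have n: "1 \<le> real n" by simp
  let ?c = "a + (real n - 1) / 2"
  have rev: "pochhammer a n = (\<Prod>i=0..<n. a + real (n - Suc i))"
    unfolding pochhammer_prod by (rule prod.reindex_bij_witness[of _ "\<lambda>i. n - Suc i" "\<lambda>i. n - Suc i"]) auto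
  have "(pochhammer a n)\<^sup>2 = (\<Prod>i=0..<n. a + real i) * (\<Prod>i=0..<n. a + real (n - Suc i))"
    unfolding power2_eq_square rev[symmetric] by (simp add: pochhammer_prod)
  also have "\<dots> = (\<Prod>i=0..<n. (a + real i) * (a + real (n - Suc i)))"
    by (simp add: prod.distrib)
  also have "\<dots> \<le> (\<Prod>i=0..<n. ?c\<^sup>2)"
  proof (intro prod_mono conjI)
    fix i assume "i \<in> {0..<n}"
    then have *: "real (n - Suc i) = real n - 1 - real i" by (simp add: of_nat_diff)
    show "0 \<le> (a + real i) * (a + real (n - Suc i))" using assms by simp
    have "?c\<^sup>2 - (a + real i) * (a + real (n - Suc i)) = ((real n - 1) / 2 - real i)\<^sup>2"
      unfolding * by (simp add: power2_eq_square field_simps)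
    then show "(a + real i) * (a + real (n - Suc i)) \<le> ?c\<^sup>2"
      by (metis diff_ge_0_iff_ge zero_le_power2)
  qed
  also have "\<dots> = (?c ^ n)\<^sup>2" 
    by (simp only: prod_power_distrib[symmetric] prod_constant card_atLeastLessThan diff_zero)
  finally show ?thesis
    by (rule power2_le_imp_le) (use n assms in simp)
qed simp

lemma partitional_pochhammer_le_power:
  assumes \<kappa>: "\<kappa> \<in> partitions k n" and "n \<le> d"
  shows "partitional_pochhammer (real d / 2) \<kappa> \<le> ((real d + real k) / 2) ^ k"
proof -
  let ?l = "part_length \<kappa>"
  have "partitional_pochhammer (real d / 2) \<kappa> \<le> (\<Prod>i<?l. ((real d + real k) / 2) ^ \<kappa> i)"
    unfolding partitional_pochhammer_def
  proof (intro prod_mono conjI)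
    fix i assume i: "i \<in> {..<?l}"
    then have pos: "0 < real d / 2 - real i / 2"
      using assms by (auto simp: partitions_def)
    then show "0 \<le> pochhammer (real d / 2 - real i / 2) (\<kappa> i)"
      by (rule pochhammer_nonneg)
    have "\<kappa> i \<le> (\<Sum>i<?l. \<kappa> i)" using i by (intro member_le_sum) auto
    then have "\<kappa> i \<le> k" by (simp add: sum_partition[OF \<kappa>])
    have "\<kappa> i \<noteq> 0" using i \<kappa> is_partition_nonzero_iff[of \<kappa> i] by (auto simp: partitions_def)
    have "pochhammer (real d / 2 - real i / 2) (\<kappa> i) \<le>
        (real d / 2 - real i / 2 + (real (\<kappa> i) - 1) / 2) ^ \<kappa> i"
      using pos by (intro pochhammer_le_power) auto
    also have "\<dots> \<le> ((real d + real k) / 2) ^ \<kappa> i"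
      using \<open>\<kappa> i \<le> k\<close> \<open>\<kappa> i \<noteq> 0\<close> pos by (intro power_mono) (auto simp: field_simps)
    finally show "pochhammer (real d / 2 - real i / 2) (\<kappa> i) \<le> ((real d + real k) / 2) ^ \<kappa> i" .
  qed
  also have "\<dots> = ((real d + real k) / 2) ^ k"
    by (simp add: sum_partition[OF \<kappa>] flip: power_sum)
  finally show ?thesis .
qed

text \<open>The quotient of factorials is the shifted factorial of \<open>l - i\<close> of length
  \<open>2 * x\<close>, which increases when \<open>l\<close> is replaced by \<open>n\<close>. The
  duplication formula splits it into two shifted factorials at half arguments; one appears in the
  claim and \<open>pochhammer_half_le\<close> bounds the other.\<close>

lemma zonal_identity_factor_ge:
  assumes "l \<le> n" "i < l"
  shows "1 / (fact x * (1 + real x) ^ (n - 1 - i)) \<le>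
    4 ^ x * pochhammer (real n / 2 - real i / 2) x * fact (l - 1 - i) / fact (2 * x + l - (i + 1))"
proof -
  let ?c = "n - 1 - i"
  have c1: "real ?c + 1 = 2 * (real n / 2 - real i / 2)"
    and c2: "real ?c / 2 + 1 = real n / 2 - real i / 2 + 1 / 2"
    using assms by (simp_all add: of_nat_diff field_simps)
  have pos: "0 < pochhammer (real n / 2 - real i / 2) x" "0 < pochhammer (real ?c / 2 + 1) x"
    using assms by (auto intro!: pochhammer_pos simp del: of_nat_diff intro: add_nonneg_pos)
  have "fact (2 * x + l - (i + 1)) / fact (l - 1 - i) = pochhammer (real (l - 1 - i) + 1) (2 * x)"
    using assms unfolding pochhammer_nat_Suc by (simp add: add.commute)
  also have "\<dots> \<le> pochhammer (real ?c + 1) (2 * x)"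
    unfolding pochhammer_prod using assms by (intro prod_mono) auto
  also have "\<dots> = 4 ^ x * pochhammer (real n / 2 - real i / 2) x * pochhammer (real ?c / 2 + 1) x"
    unfolding c1 c2 pochhammer_double by (simp add: power_mult)
  also have "\<dots> \<le> 4 ^ x * pochhammer (real n / 2 - real i / 2) x * (fact x * (1 + real x) ^ ?c)"
    using pos pochhammer_half_le[of ?c x] by (intro mult_left_mono) auto
  finally show ?thesis by (simp add: field_simps)
qed

text \<open>The difference product is bounded below by its value at equal parts, \<open>\<Prod>i<l. (l - 1 - i)!\<close>.\<close>

lemma zonal_identity_ge:
  assumes \<kappa>: "\<kappa> \<in> partitions k n"
  shows "fact k / ((\<Prod>i<part_length \<kappa>. fact (\<kappa> i)) * (1 + real k) ^ (\<Sum>i<n. n - 1 - i))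
    \<le> zonal_identity n \<kappa>"
proof -
  let ?l = "part_length \<kappa>"
  let ?D = "(\<Prod>(i, j) \<in> {(i, j). i < j \<and> j < ?l}. 2 * real (\<kappa> i) - 2 * real (\<kappa> j) - real i + real j)"
  let ?F = "(\<Prod>i<?l. fact (2 * \<kappa> i + ?l - (i + 1))) :: real"
  have l: "?l \<le> n" using \<kappa> by (simp add: partitions_def)
  have le: "\<kappa> i \<le> k" if "i < ?l" for i
    using member_le_sum[of i "{..<?l}" \<kappa>] that by (simp add: sum_partition[OF \<kappa>])
  \<comment> \<open>Replacing each part by \<open>k\<close> and extending the sum to all
    \<open>i < n\<close> makes the loss independent of the partition.\<close>
  have "(\<Prod>i<?l. (1 + real (\<kappa> i)) ^ (n - 1 - i)) \<le> (\<Prod>i<?l. (1 + real k) ^ (n - 1 - i))"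
    using le by (intro prod_mono conjI power_mono) auto
  also have "\<dots> = (1 + real k) ^ (\<Sum>i<?l. n - 1 - i)"
    by (simp add: power_sum)
  also have "\<dots> \<le> (1 + real k) ^ (\<Sum>i<n. n - 1 - i)"
    using l by (intro power_increasing sum_mono2) auto
  finally have "fact k / ((\<Prod>i<?l. fact (\<kappa> i)) * (1 + real k) ^ (\<Sum>i<n. n - 1 - i)) \<le>
      fact k / ((\<Prod>i<?l. fact (\<kappa> i)) * (\<Prod>i<?l. (1 + real (\<kappa> i)) ^ (n - 1 - i)))"
    by (intro divide_left_mono mult_left_mono mult_pos_pos prod_pos prod_nonneg) auto
  also have "\<dots> = fact k * (\<Prod>i<?l. 1 / (fact (\<kappa> i) * (1 + real (\<kappa> i)) ^ (n - 1 - i)))"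
    by (simp add: prod_dividef prod.distrib)
  also have "\<dots> \<le> fact k * (\<Prod>i<?l. 4 ^ \<kappa> i * pochhammer (real n / 2 - real i / 2) (\<kappa> i) *
      fact (?l - 1 - i) / fact (2 * \<kappa> i + ?l - (i + 1)))"
    using zonal_identity_factor_ge[OF l] by (intro mult_left_mono prod_mono) auto
  also have "\<dots> = fact k * (4 ^ k * partitional_pochhammer (real n / 2) \<kappa> * (\<Prod>i<?l. fact (?l - 1 - i)) / ?F)"
    by (simp add: prod_dividef prod.distrib partitional_pochhammer_def sum_partition[OF \<kappa>] flip: power_sum)
  also have "\<dots> \<le> fact k * (4 ^ k * partitional_pochhammer (real n / 2) \<kappa> * ?D / ?F)"
    using partition_difference_product_bounds(1)[OF \<kappa> refl] partitional_pochhammer_pos[OF \<kappa> order_refl]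
    by (intro mult_left_mono divide_right_mono prod_nonneg) auto
  also have "\<dots> = zonal_identity n \<kappa>"
    using \<kappa> by (simp add: zonal_identity_def Let_def partitions_def power_mult)
  finally show ?thesis .
qed

text \<open>Units are dealt to the \<open>p\<close> parts in cyclic order. From \<open>k\<close> to
  \<open>k + 1\<close> the left side grows by the factor \<open>p * (k div p + 1)\<close>, at most
  \<open>k + p\<close>, and Bernoulli's inequality compares this with the growth of the right
  side.\<close>

lemma balanced_partition_exists:
  assumes "1 \<le> p"
  shows "\<exists>\<kappa>\<in>partitions k p. real p ^ k * (\<Prod>i<part_length \<kappa>. fact (\<kappa> i)) \<le> fact k * (1 + real k) ^ (p - 1)"
proof -
  \<comment> \<open>Part \<open>i < p\<close> is (k - i)/p rounded up, so the parts decrease in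
    \<open>i\<close> and differ by at most one.\<close>
  define \<kappa> where "\<kappa> k i = (if i < p then (k + p - 1 - i) div p else 0)" for k i
  have step: "\<kappa> (Suc k) i = \<kappa> k i + (if i = k mod p then 1 else 0)" if "i < p" for k i
  proof -
    define n where "n = k + p - 1 - i"
    have n: "Suc k + p - 1 - i = Suc n" "Suc n = k + p - i"
      using that by (auto simp: n_def)
    have "Suc n mod p = 0 \<longleftrightarrow> (k + p) mod p = i mod p"
      using that mod_eq_dvd_iff_nat[of i "k + p" p] by (simp add: n(2) dvd_eq_mod_eq_0)
    then have "Suc n mod p = 0 \<longleftrightarrow> i = k mod p"
      using that by auto
    moreover have "Suc n div p = n div p + (if Suc n mod p = 0 then 1 else 0)"
      by (simp add: div_Suc)
    ultimately show ?thesis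
      using that by (simp only: \<kappa>_def n(1) n_def[symmetric] if_True)
  qed
  have r: "k mod p < p" for k using assms by simp
  have \<kappa>_r: "\<kappa> k (k mod p) = k div p" for k
  proof -
    have "k + p - 1 - k mod p = (p - 1) + p * (k div p)"
      using assms mult_div_mod_eq[of p k] by linarith
    moreover have "((p - 1) + p * (k div p)) div p = k div p"
      using assms by (subst div_mult_self2) auto
    ultimately show ?thesis using r[of k] by (simp only: \<kappa>_def if_True)
  qed
  have sum: "(\<Sum>i<p. \<kappa> k i) = k" for k
  proof (induction k)
    case 0
    show ?case using assms by (simp add: \<kappa>_def)
  next
    case (Suc k)
    have "(\<Sum>i<p. \<kappa> (Suc k) i) = (\<Sum>i<p. \<kappa> k i + (if i = k mod p then 1 else 0))"
      by (intro sum.cong) (auto simp: step)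
    then show ?case using Suc.IH r[of k] by (simp add: sum.distrib)
  qed
  have prod: "real p ^ k * (\<Prod>i<p. fact (\<kappa> k i)) \<le> fact k * (1 + real k) ^ (p - 1)" for k
  proof (induction k)
    case 0
    show ?case using assms by (simp add: \<kappa>_def)
  next
    case (Suc k)
    have "(\<Prod>i<p. fact (\<kappa> (Suc k) i) :: real) =
        (\<Prod>i<p. fact (\<kappa> k i) * (if i = k mod p then real (k div p + 1) else 1))"
      by (intro prod.cong refl) (use step \<kappa>_r[of k] in auto)
    also have "\<dots> = (\<Prod>i<p. fact (\<kappa> k i)) * real (k div p + 1)"
      using r[of k] by (simp add: prod.distrib)
    finally have 1: "(\<Prod>i<p. fact (\<kappa> (Suc k) i) :: real) = \<dots>" .
    \<comment> \<open>Bernoulli's inequality, with exponent \<open>p - 1\<close> and increment 1/(1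
      + k), produces exactly the ratio of consecutive values of (1 + k) to the power
      \<open>p - 1\<close>.\<close>
    have "real (p * (k div p + 1)) \<le> real (k + p)"
      unfolding of_nat_le_iff using mult_div_mod_eq[of p k] by (simp only: distrib_left)
    also have "\<dots> = (1 + real k) * (1 + real (p - 1) * (1 / (1 + real k)))"
      using assms by (simp add: field_simps of_nat_diff)
    also have "\<dots> \<le> (1 + real k) * (1 + 1 / (1 + real k)) ^ (p - 1)"
      by (intro mult_left_mono Bernoulli_inequality) (auto intro: order_trans[of _ 0])
    also have "1 + 1 / (1 + real k) = (2 + real k) / (1 + real k)"
      by (simp add: field_simps)
    also have "(1 + real k) * \<dots> ^ (p - 1) = (1 + real k) * (2 + real k) ^ (p - 1) / (1 + real k) ^ (p - 1)"
      by (simp only: power_divide times_divide_eq_right)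
    finally have 2: "real p * real (k div p + 1) * (1 + real k) ^ (p - 1) \<le>
        (1 + real k) * (2 + real k) ^ (p - 1)"
      by (simp only: pos_le_divide_eq zero_less_power of_nat_mult)
    have "real p ^ Suc k * (\<Prod>i<p. fact (\<kappa> (Suc k) i)) =
        (real p * real (k div p + 1)) * (real p ^ k * (\<Prod>i<p. fact (\<kappa> k i)))"
      unfolding 1 power_Suc by (simp only: mult_ac)
    also have "\<dots> \<le> (real p * real (k div p + 1)) * (fact k * (1 + real k) ^ (p - 1))"
      using Suc.IH by (intro mult_left_mono) auto
    also have "\<dots> = fact k * (real p * real (k div p + 1) * (1 + real k) ^ (p - 1))"
      by (simp only: mult_ac)
    also have "\<dots> \<le> fact k * ((1 + real k) * (2 + real k) ^ (p - 1))"
      using 2 by (intro mult_left_mono) auto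
    also have "\<dots> = fact (Suc k) * (1 + real (Suc k)) ^ (p - 1)"
      by simp
    finally show ?case .
  qed
  have supp: "{j. \<kappa> k j \<noteq> 0} \<subseteq> {..<p}" by (auto simp: \<kappa>_def)
  have "antimono (\<kappa> k)"
    by (rule antimonoI) (auto simp: \<kappa>_def intro!: div_le_mono)
  then have part: "is_partition (\<kappa> k)"
    using finite_subset[OF supp] by (simp add: is_partition_def)
  have len: "part_length (\<kappa> k) \<le> p"
    using card_mono[OF _ supp] by (simp add: part_length_def)
  have "part_weight (\<kappa> k) = (\<Sum>i<p. \<kappa> k i)"
    unfolding part_weight_def using supp by (intro sum.mono_neutral_left) auto
  then have mem: "\<kappa> k \<in> partitions k p"
    using part len sum by (simp add: partitions_def)
  have "(\<Prod>i<part_length (\<kappa> k). fact (\<kappa> k i) :: real) = (\<Prod>i<p. fact (\<kappa> k i))"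
  proof (rule prod.mono_neutral_left)
    show "\<forall>i\<in>{..<p} - {..<part_length (\<kappa> k)}. (fact (\<kappa> k i) :: real) = 1"
    proof
      fix i assume "i \<in> {..<p} - {..<part_length (\<kappa> k)}"
      then have "\<kappa> k i = 0" using is_partition_nonzero_iff[OF part, of i] by blast
      then show "(fact (\<kappa> k i) :: real) = 1" by (simp only: fact_0)
    qed
  qed (use len in auto)
  with mem prod[of k] show ?thesis by (intro bexI[of _ "\<kappa> k"]) (simp_all only:)
qed

text \<open>The multinomial coefficient is a product of binomial coefficients, each at most 2 to the
  power of the total.\<close>

lemma fact_sum_le:
  "fact (\<Sum>i<n. f i) \<le> (2 ^ n) ^ (\<Sum>i<n. f i) * (\<Prod>i<n. fact (f i) :: real)" for f :: "nat \<Rightarrow> nat"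
proof (induction n)
  case (Suc n)
  let ?s = "\<Sum>i<n. f i"
  have "fact (?s + f n) = real ((?s + f n) choose f n) * (fact ?s * fact (f n))"
    using binomial_fact[of "f n" "?s + f n", where 'a = real] by simp
  also have "\<dots> \<le> 2 ^ (?s + f n) * (((2 ^ n) ^ ?s * (\<Prod>i<n. fact (f i))) * fact (f n))"
    using Suc.IH of_nat_mono[OF binomial_le_pow2[of "?s + f n" "f n"], where 'a = real]
    by (intro mult_mono mult_right_mono) auto
  also have "\<dots> \<le> 2 ^ (?s + f n) * (((2 ^ n) ^ (?s + f n) * (\<Prod>i<n. fact (f i))) * fact (f n))"
    by (intro mult_left_mono mult_right_mono power_increasing prod_nonneg) auto
  also have "\<dots> = (2 ^ Suc n) ^ (?s + f n) * ((\<Prod>i<n. fact (f i)) * fact (f n))"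
    by (simp add: power_mult_distrib)
  finally show ?case by simp
qed simp

section \<open>Zonal polynomials of positive semidefinite matrices\<close>

lemma prob_space_haar:
  "prob_space (haar_orthogonal :: (real^'n::{finite,wellorder}^'n::_) measure)"
  and sets_haar:
  "sets (haar_orthogonal :: (real^'n::{finite,wellorder}^'n::_) measure) =
    sets (restrict_space borel orthogonal_group)"
  using normalized_haar_haar_orthogonal by (auto simp: normalized_haar_def)

lemma space_haar:
  "space (haar_orthogonal :: (real^'n::{finite,wellorder}^'n::_) measure) = orthogonal_group"
  using sets_eq_imp_space_eq[OF sets_haar] by (simp add: space_restrict_space)

lemma compact_orthogonal_group: "compact (orthogonal_group :: (real^'n^'n) set)"
proof (rule compact_eq_bounded_closed[THEN iffD2], rule conjI)
  have "norm Q \<le> CARD('n)" if "orthogonal_matrix Q" for Q :: "real^'n^'n"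
  proof -
    have "norm (Q $ i) = 1" for i
      using that[unfolded orthogonal_matrix_orthonormal_rows] by (simp add: row_def)
    then show ?thesis
      unfolding norm_vec_def[of Q] using L2_set_le_sum[of UNIV "\<lambda>i. norm (Q $ i)"] by simp
  qed
  then show "bounded (orthogonal_group :: (real^'n^'n) set)"
    unfolding bounded_iff orthogonal_group_def by blast
  have "closed {Q :: real^'n^'n. transpose Q ** Q = mat 1}"
    unfolding matrix_matrix_mult_def transpose_def
    by (intro closed_Collect_eq continuous_intros)
  then show "closed (orthogonal_group :: (real^'n^'n) set)"
    by (simp add: orthogonal_group_def orthogonal_matrix)
qed

lemma continuous_on_leading_minor_conjugate:
  "continuous_on A (\<lambda>H. leading_minor j (transpose H ** S ** H))"
  unfolding leading_minor_def matrix_matrix_mult_def transpose_def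
  by (simp, intro continuous_intros)

lemma conjugate_quadratic_form:
  fixes S :: "real^'n^'n"
  assumes "orthogonal_matrix H" and S: "\<And>x. b * (x \<bullet> x) \<le> x \<bullet> (S *v x)"
  shows "b * (x \<bullet> x) \<le> x \<bullet> ((transpose H ** S ** H) *v x)"
proof -
  have adj: "y \<bullet> (transpose H *v z) = (H *v y) \<bullet> z" for y z
    using dot_lmul_matrix[of z H y] by (simp only: transpose_matrix_vector inner_commute)
  have "transpose H *v (H *v x) = x"
    using assms(1) by (simp only: matrix_vector_mul_assoc orthogonal_matrix matrix_vector_mul_lid)
  then have "(H *v x) \<bullet> (H *v x) = x \<bullet> x"
    using adj[of x "H *v x"] by (simp only:)
  moreover have "x \<bullet> ((transpose H ** S ** H) *v x) = (H *v x) \<bullet> (S *v (H *v x))"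
    using adj[of x "S *v (H *v x)"] by (simp only: matrix_vector_mul_assoc matrix_mul_assoc)
  ultimately show ?thesis using S[of "H *v x"] by simp
qed

text \<open>On the orthogonal group the \<open>j\<close>-th minor lies between the
  \<open>j\<close>-th powers of \<open>b\<close> and of some \<open>K\<close>, so
  \<open>prod_power_partition\<close> puts the integrand between \<open>b ^ k\<close> and
  \<open>K ^ k\<close>. Averaging preserves both bounds, and \<open>K\<close> depends on neither
  \<open>k\<close> nor the partition.\<close>

lemma zonal_bounds:
  fixes S :: "real^'n::{finite,wellorder}^'n::_"
  assumes S: "\<And>x. b * (x \<bullet> x) \<le> x \<bullet> (S *v x)" and b: "0 \<le> b"
  shows zonal_ge: "\<And>k \<kappa>. \<kappa> \<in> partitions k CARD('n) \<Longrightarrow> zonal_identity CARD('n) \<kappa> * b ^ k \<le> zonal \<kappa> S"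
    and zonal_le: "\<exists>K\<ge>1. \<forall>k. \<forall>\<kappa>\<in>partitions k CARD('n). zonal \<kappa> S \<le> zonal_identity CARD('n) \<kappa> * K ^ k"
proof -
  interpret prob_space "haar_orthogonal :: (real^'n::_^'n::_) measure"
    by (rule prob_space_haar)
  let ?m = "\<lambda>j H. leading_minor j (transpose H ** S ** H)"
  let ?f = "\<lambda>\<kappa> H. \<Prod>j = 1..part_length \<kappa>. ?m j H ^ (\<kappa> (j - 1) - \<kappa> j)"
  have low: "b ^ j \<le> ?m j H" if "H \<in> orthogonal_group" "j \<le> CARD('n)" for H j
    using that by (intro power_le_leading_minor conjugate_quadratic_form S b)
      (auto simp: orthogonal_group_def)
  \<comment> \<open>Summing the absolute values of all minors gives one bound for every
    \<open>j\<close> at once.\<close>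
  have "compact ((\<lambda>H. \<Sum>j\<le>CARD('n). \<bar>?m j H\<bar>) ` orthogonal_group)"
    by (intro compact_continuous_image compact_orthogonal_group continuous_intros
        continuous_on_leading_minor_conjugate)
  then have "bounded ((\<lambda>H. \<Sum>j\<le>CARD('n). \<bar>?m j H\<bar>) ` orthogonal_group)"
    by (rule compact_imp_bounded)
  then obtain K0 where "\<forall>y\<in>(\<lambda>H. \<Sum>j\<le>CARD('n). \<bar>?m j H\<bar>) ` orthogonal_group. norm y \<le> K0"
    unfolding bounded_iff by blast
  then have K0: "\<bar>\<Sum>j\<le>CARD('n). \<bar>?m j H\<bar>\<bar> \<le> K0" if "H \<in> orthogonal_group" for H
    using that by auto
  \<comment> \<open>The maximum with 1 ensures \<open>K \<le> K ^ j\<close> for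
    \<open>j \<ge> 1\<close>.\<close>
  define K where "K = max 1 K0"
  have K: "1 \<le> K" by (simp add: K_def)
  have up: "?m j H \<le> K ^ j" if H: "H \<in> orthogonal_group" and j: "1 \<le> j" "j \<le> CARD('n)" for H j
  proof -
    have "?m j H \<le> \<bar>?m j H\<bar>" by simp
    also have "\<dots> \<le> (\<Sum>j\<le>CARD('n). \<bar>?m j H\<bar>)"
      using j by (intro member_le_sum[of j "{..CARD('n)}" "\<lambda>j. \<bar>?m j H\<bar>"]) auto
    also have "\<dots> \<le> K" using K0[OF H] by (simp add: K_def)
    also have "\<dots> \<le> K ^ j" using K j power_increasing[of 1 j K] by simp
    finally show ?thesis .
  qed
  have bounds: "b ^ k \<le> ?f \<kappa> H \<and> ?f \<kappa> H \<le> K ^ k"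
    if "\<kappa> \<in> partitions k CARD('n)" "H \<in> orthogonal_group" for k \<kappa> H
  proof -
    have len: "part_length \<kappa> \<le> CARD('n)" using that by (simp add: partitions_def)
    have nonneg: "0 \<le> ?m j H" if "j \<le> CARD('n)" for j
      using low[OF \<open>H \<in> orthogonal_group\<close> that] zero_le_power[OF b, of j] by linarith
    have "(\<Prod>j = 1..part_length \<kappa>. (b ^ j) ^ (\<kappa> (j - 1) - \<kappa> j)) \<le> ?f \<kappa> H"
      using that len low b by (intro prod_mono conjI power_mono) auto
    moreover have "?f \<kappa> H \<le> (\<Prod>j = 1..part_length \<kappa>. (K ^ j) ^ (\<kappa> (j - 1) - \<kappa> j))"
      using that len up nonneg by (intro prod_mono conjI power_mono) auto
    ultimately show ?thesis by (simp only: prod_power_partition[OF that(1)])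
  qed
  have AE: "AE H in haar_orthogonal. b ^ k \<le> ?f \<kappa> H \<and> ?f \<kappa> H \<le> K ^ k"
    if "\<kappa> \<in> partitions k CARD('n)" for k \<kappa>
    using bounds[OF that] by (intro AE_I2) (simp add: space_haar)
  have int: "integrable haar_orthogonal (?f \<kappa>)" if "\<kappa> \<in> partitions k CARD('n)" for k \<kappa>
  proof (rule integrable_const_bound[where B = "K ^ k"])
    show "AE H in haar_orthogonal. norm (?f \<kappa> H) \<le> K ^ k"
      using AE[OF that]
    proof eventually_elim
      case (elim H)
      then show ?case
        using zero_le_power[OF b, of k] unfolding real_norm_def by linarith
    qed
    have "?f \<kappa> \<in> borel_measurable borel"
      by (intro borel_measurable_continuous_onI continuous_intros continuous_on_leading_minor_conjugate)
    then show "?f \<kappa> \<in> borel_measurable haar_orthogonal"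
      unfolding measurable_cong_sets[OF sets_haar refl] by (rule measurable_restrict_space1)
  qed
  show "zonal_identity CARD('n) \<kappa> * b ^ k \<le> zonal \<kappa> S" if "\<kappa> \<in> partitions k CARD('n)" for k \<kappa>
    unfolding zonal_def using AE[OF that]
    by (intro mult_left_mono integral_ge_const int[OF that] zonal_identity_nonneg[OF that])
      (auto elim!: eventually_mono)
  have "zonal \<kappa> S \<le> zonal_identity CARD('n) \<kappa> * K ^ k" if "\<kappa> \<in> partitions k CARD('n)" for k \<kappa>
    unfolding zonal_def using AE[OF that]
    by (intro mult_left_mono integral_le_const int[OF that] zonal_identity_nonneg[OF that])
      (auto elim!: eventually_mono)
  with K show "\<exists>K\<ge>1. \<forall>k. \<forall>\<kappa>\<in>partitions k CARD('n). zonal \<kappa> S \<le> zonal_identity CARD('n) \<kappa> * K ^ k"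
    by blast
qed

section \<open>Lower bound for the terms of the series, and convergence\<close>

lemma partitional_pochhammer_mono:
  assumes \<kappa>: "\<kappa> \<in> partitions k n" and "n \<le> d"
  shows "partitional_pochhammer (real n / 2) \<kappa> \<le> partitional_pochhammer (real d / 2) \<kappa>"
  unfolding partitional_pochhammer_def pochhammer_prod
  using assms by (intro prod_mono conjI prod_nonneg) (auto simp: partitions_def)

text \<open>All summands are nonnegative, so the balanced partition alone bounds the inner sum. The
  base combines \<open>p\<close> from the multinomial coefficient, \<open>b\<close> from the minors
  and 2 from the halves in the bound for the shifted factorial.\<close>

lemma zonal_series_term_ge:
  fixes S :: "real^'n::{finite,wellorder}^'n::_"
  assumes S: "\<And>x. b * (x \<bullet> x) \<le> x \<bullet> (S *v x)" and b: "0 \<le> b" and "CARD('n) \<le> d"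
  shows "(2 * real CARD('n) * b) ^ k / (fact k *
      (1 + real k) ^ (CARD('n) - 1 + (\<Sum>i<CARD('n). CARD('n) - 1 - i)) * (real d + real k) ^ k) \<le>
    1 / fact k * (\<Sum>\<kappa>\<in>partitions k CARD('n). zonal \<kappa> S / partitional_pochhammer (real d / 2) \<kappa>)"
    (is "?L \<le> _ * (\<Sum>\<kappa>\<in>_. ?t \<kappa>)")
proof -
  let ?p = "CARD('n)" let ?E = "\<Sum>i<CARD('n). CARD('n) - 1 - i"
  have zonal_nonneg: "0 \<le> zonal \<kappa> S" if "\<kappa> \<in> partitions k ?p" for \<kappa>
    using order_trans[OF _ zonal_ge[OF S b that]] zonal_identity_nonneg[OF that] b by auto
  have nonneg: "0 \<le> ?t \<kappa>" if "\<kappa> \<in> partitions k ?p" for \<kappa>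
    using zonal_nonneg[OF that] partitional_pochhammer_pos[OF that \<open>?p \<le> d\<close>]
    by (auto intro: divide_nonneg_pos)
  obtain \<kappa> where \<kappa>: "\<kappa> \<in> partitions k ?p" and
    bal: "real ?p ^ k * (\<Prod>i<part_length \<kappa>. fact (\<kappa> i)) \<le> fact k * (1 + real k) ^ (?p - 1)"
    using balanced_partition_exists[of ?p k] by auto
  let ?F = "(\<Prod>i<part_length \<kappa>. fact (\<kappa> i)) :: real"
  have F: "0 < ?F" by (intro prod_pos) auto
  have "real ?p ^ k / (1 + real k) ^ (?p - 1 + ?E) \<le> fact k / (?F * (1 + real k) ^ ?E)"
  proof -
    have "real ?p ^ k / (1 + real k) ^ (?p - 1) \<le> fact k / ?F"
      using bal F by (simp add: pos_divide_le_eq pos_le_divide_eq mult.commute)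
    moreover have "0 \<le> (1 + real k) ^ ?E" by simp
    ultimately have "real ?p ^ k / (1 + real k) ^ (?p - 1) / (1 + real k) ^ ?E \<le>
        fact k / ?F / (1 + real k) ^ ?E"
      by (rule divide_right_mono)
    then show ?thesis by (simp only: power_add divide_divide_eq_left)
  qed
  also have "\<dots> \<le> zonal_identity ?p \<kappa>"
    by (rule zonal_identity_ge[OF \<kappa>])
  finally have "real ?p ^ k / (1 + real k) ^ (?p - 1 + ?E) * b ^ k \<le> zonal_identity ?p \<kappa> * b ^ k"
    using b by (intro mult_right_mono) auto
  also have "\<dots> \<le> zonal \<kappa> S" by (rule zonal_ge[OF S b \<kappa>])
  finally have "real ?p ^ k / (1 + real k) ^ (?p - 1 + ?E) * b ^ k / ((real d + real k) / 2) ^ k \<le> ?t \<kappa>"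
    using partitional_pochhammer_le_power[OF \<kappa> \<open>?p \<le> d\<close>] partitional_pochhammer_pos[OF \<kappa> \<open>?p \<le> d\<close>] b
    by (intro frac_le zonal_nonneg[OF \<kappa>]) auto
  also have "?t \<kappa> \<le> (\<Sum>\<kappa>\<in>partitions k ?p. ?t \<kappa>)"
    using nonneg finite_partitions by (intro member_le_sum \<kappa>) auto
  finally have "1 / fact k * (real ?p ^ k / (1 + real k) ^ (?p - 1 + ?E) * b ^ k / ((real d + real k) / 2) ^ k) \<le>
      1 / fact k * (\<Sum>\<kappa>\<in>partitions k ?p. ?t \<kappa>)"
    by (intro mult_left_mono) auto
  also have "1 / fact k * (real ?p ^ k / (1 + real k) ^ (?p - 1 + ?E) * b ^ k / ((real d + real k) / 2) ^ k) = ?L"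
    by (simp add: power_mult_distrib power_divide mult_ac)
  finally show ?thesis .
qed

text \<open>Each summand and the number of summands grow at most geometrically in \<open>k\<close>,
  so division by \<open>fact k\<close> leaves a series dominated by an exponential one.\<close>

lemma zonal_series_summable:
  fixes S :: "real^'n::{finite,wellorder}^'n::_"
  assumes S: "\<And>x. 0 \<le> x \<bullet> (S *v x)" and "CARD('n) \<le> d"
  shows "summable (\<lambda>k. 1 / fact k *
    (\<Sum>\<kappa>\<in>partitions k CARD('n). zonal \<kappa> S / partitional_pochhammer (real d / 2) \<kappa>))"
    (is "summable (\<lambda>k. _ * (\<Sum>\<kappa>\<in>_. ?t \<kappa>))")
proof -
  let ?n = "CARD('n)"
  \<comment> \<open>With \<open>b = 0\<close>, \<open>zonal_ge\<close> yields nonnegativity of every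
    zonal polynomial here.\<close>
  have S': "0 * (x \<bullet> x) \<le> x \<bullet> (S *v x)" for x using S by simp
  obtain K where K: "1 \<le> K" and le: "\<And>k \<kappa>. \<kappa> \<in> partitions k ?n \<Longrightarrow> zonal \<kappa> S \<le> zonal_identity ?n \<kappa> * K ^ k"
    using zonal_le[OF S'] by auto
  have nonneg: "0 \<le> ?t \<kappa>" if "\<kappa> \<in> partitions k ?n" for k \<kappa>
    using order_trans[OF _ zonal_ge[OF S' order_refl that]] zonal_identity_nonneg[OF that]
      partitional_pochhammer_pos[OF that \<open>?n \<le> d\<close>] by (auto intro: divide_nonneg_pos)
  have term_le: "?t \<kappa> \<le> (4 * K * 2 ^ ?n) ^ k" if \<kappa>: "\<kappa> \<in> partitions k ?n" for k \<kappa>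
  proof -
    let ?l = "part_length \<kappa>" let ?F = "(\<Prod>i<part_length \<kappa>. fact (2 * \<kappa> i)) :: real"
    let ?q = "partitional_pochhammer (real d / 2) \<kappa>"
    have F: "0 < ?F" by (intro prod_pos) auto
    have q: "0 < ?q" by (rule partitional_pochhammer_pos[OF \<kappa> \<open>?n \<le> d\<close>])
    have "fact k \<le> (2 ^ ?l) ^ k * (\<Prod>i<?l. fact (\<kappa> i) :: real)"
      using fact_sum_le[of \<kappa> ?l] by (simp add: sum_partition[OF \<kappa>])
    also have "\<dots> \<le> (2 ^ ?n) ^ k * ?F"
      using \<kappa> by (intro mult_mono power_mono power_increasing prod_mono prod_nonneg conjI fact_mono)
        (auto simp: partitions_def)
    finally have fact: "fact k / ?F \<le> (2 ^ ?n) ^ k" using F by (simp add: divide_le_eq)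
    have "zonal_identity ?n \<kappa> \<le> 4 ^ k * (fact k / ?F) * partitional_pochhammer (real ?n / 2) \<kappa>"
      using zonal_identity_le[OF \<kappa>] by (simp add: mult_ac)
    \<comment> \<open>Passing from n/2 to d/2 lets the shifted factorial in
      \<open>zonal_identity\<close> cancel against the denominator of the series.\<close>
    also have "\<dots> \<le> 4 ^ k * (2 ^ ?n) ^ k * ?q"
      using fact F partitional_pochhammer_mono[OF \<kappa> \<open>?n \<le> d\<close>] partitional_pochhammer_pos[OF \<kappa> order_refl]
      by (intro mult_mono) auto
    finally have "zonal_identity ?n \<kappa> * K ^ k \<le> 4 ^ k * (2 ^ ?n) ^ k * ?q * K ^ k"
      using K by (intro mult_right_mono) auto
    with le[OF \<kappa>] have "zonal \<kappa> S \<le> (4 * K * 2 ^ ?n) ^ k * ?q"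
      by (simp add: power_mult_distrib mult_ac)
    then show ?thesis using q by (simp add: divide_le_eq)
  qed
  have "norm (1 / fact k * (\<Sum>\<kappa>\<in>partitions k ?n. ?t \<kappa>)) \<le> inverse (fact k) * (2 ^ ?n * (4 * K * 2 ^ ?n)) ^ k" for k
  proof -
    have "k + 1 \<le> 2 ^ k" by (induction k) auto
    then have "(k + 1) ^ ?n \<le> (2 ^ ?n) ^ k"
      using power_mono[of "k + 1" "2 ^ k" ?n] by (simp add: mult.commute flip: power_mult)
    then have "card (partitions k ?n) \<le> (2 ^ ?n) ^ k"
      using card_partitions_le[of k ?n] by simp
    then have card: "real (card (partitions k ?n)) \<le> (2 ^ ?n) ^ k"
      by (metis of_nat_le_iff of_nat_numeral of_nat_power)
    have "(\<Sum>\<kappa>\<in>partitions k ?n. ?t \<kappa>) \<le> real (card (partitions k ?n)) * (4 * K * 2 ^ ?n) ^ k"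
      using term_le by (rule sum_bounded_above)
    also have "\<dots> \<le> (2 ^ ?n) ^ k * (4 * K * 2 ^ ?n) ^ k"
      using card K by (intro mult_right_mono) auto
    finally have "(\<Sum>\<kappa>\<in>partitions k ?n. ?t \<kappa>) \<le> (2 ^ ?n * (4 * K * 2 ^ ?n)) ^ k"
      by (simp add: power_mult_distrib)
    moreover have "0 \<le> (\<Sum>\<kappa>\<in>partitions k ?n. ?t \<kappa>)"
      using nonneg by (rule sum_nonneg)
    ultimately show ?thesis by (simp add: field_simps)
  qed
  then show ?thesis
    using summable_exp by (rule summable_comparison_test'[rotated, where N = 0])
qed

section \<open>The remainder of the series\<close>

lemma transpose_times_self_quadratic_form:
  fixes B :: "real^'p^'d"
  shows "x \<bullet> ((transpose B ** B) *v x) = (B *v x) \<bullet> (B *v x)"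
proof -
  have "(B *v x) \<bullet> (B *v x) = ((B *v x) v* B) \<bullet> x"
    by (simp only: dot_lmul_matrix)
  then show ?thesis
    by (simp only: transpose_matrix_vector[symmetric] matrix_vector_mul_assoc inner_commute)
qed

text \<open>The minimum of the form on the unit sphere is an eigenvalue, hence some
  \<open>\<beta> i\<close>, and no \<open>\<beta> i\<close> lies below the last one.\<close>

lemma ordered_eigenvalues_quadratic_form:
  fixes S :: "real^'n^'n"
  assumes sym: "transpose S = S" and \<beta>: "ordered_eigenvalues S \<beta>"
  shows "\<beta> CARD('n) * (x \<bullet> x) \<le> x \<bullet> (S *v x)"
proof -
  obtain v c where v: "v \<noteq> 0" "S *v v = c *\<^sub>R v" and c: "\<And>x. c * (x \<bullet> x) \<le> x \<bullet> (S *v x)"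
    using symmetric_matrix_least_eigenvalue[OF sym] by metis
  have "mat c *v v = c *\<^sub>R v"
    by (auto simp: vec_eq_iff matrix_vector_mult_def mat_def if_distrib[of "\<lambda>u. u * _"] cong: if_cong)
  then have "(mat c - S) *v v = 0"
    using v(2) by (simp add: matrix_vector_mult_diff_rdistrib)
  then have "det (mat c - S) = 0"
    using v(1) by (metis invertible_det_nz invertible_left_inverse matrix_left_invertible_ker)
  then have "(\<Prod>i = 1..CARD('n). c - \<beta> i) = 0"
    using \<beta> by (simp add: ordered_eigenvalues_def)
  then obtain i where "1 \<le> i" "i \<le> CARD('n)" "c = \<beta> i" by auto
  then have "\<beta> CARD('n) \<le> c" using \<beta> by (auto simp: ordered_eigenvalues_def)
  then have "\<beta> CARD('n) * (x \<bullet> x) \<le> c * (x \<bullet> x)" by (rule mult_right_mono) simp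
  then show ?thesis using c[of x] by linarith
qed

lemma ordered_eigenvalues_nonneg:
  fixes S :: "real^'n^'n"
  assumes "\<And>x. 0 \<le> x \<bullet> (S *v x)" and \<beta>: "ordered_eigenvalues S \<beta>"
  shows "0 \<le> \<beta> CARD('n)"
proof -
  let ?b = "\<beta> CARD('n)"
  have "det (mat ?b - S) = (\<Prod>i = 1..CARD('n). ?b - \<beta> i)"
    using \<beta> by (simp add: ordered_eigenvalues_def)
  also have "\<dots> = 0"
    by (rule prod_zero) (auto intro: bexI[of _ "CARD('n)"])
  finally have "\<not> invertible (mat ?b - S)" by (simp add: invertible_det_nz)
  then obtain v where v: "v \<noteq> 0" "(mat ?b - S) *v v = 0"
    by (metis invertible_left_inverse matrix_left_invertible_ker)
  have "mat ?b *v v = ?b *\<^sub>R v"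
    by (auto simp: vec_eq_iff matrix_vector_mult_def mat_def if_distrib[of "\<lambda>u. u * _"] cong: if_cong)
  then have "S *v v = ?b *\<^sub>R v"
    using v(2) by (simp add: matrix_vector_mult_diff_rdistrib)
  then have "0 \<le> ?b * (v \<bullet> v)" using assms(1)[of v] by simp
  moreover have "0 < v \<bullet> v" using v(1) by simp
  ultimately show ?thesis by (simp only: zero_le_mult_iff) linarith
qed

text \<open>Going from \<open>j\<close> to \<open>j + 1\<close>, one factor d + m + j + 1 is the new
  factor of the shifted factorial. The remaining power costs at most a factor e, since
  \<open>(x + 1) ^ k \<le> exp 1 * x ^ k\<close> for \<open>x \<ge> k\<close>.\<close>

lemma add_power_le_exp_pochhammer:
  "(real d + real (m + j)) ^ (m + j) \<le> (real d + real m) ^ m * exp (real j) * pochhammer (real d + 1 + real m) j"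
proof (induction j)
  case (Suc j)
  let ?x = "real d + real (m + j)"
  have "(?x + 1) ^ (m + j) \<le> ?x ^ (m + j) * exp 1"
  proof (cases "m + j = 0")
    case False
    then have x: "0 < ?x" by linarith
    have "(?x + 1) ^ (m + j) = ?x ^ (m + j) * (1 + 1 / ?x) ^ (m + j)"
      using x by (simp add: field_simps flip: power_mult_distrib)
    also have "(1 + 1 / ?x) ^ (m + j) \<le> exp (1 / ?x) ^ (m + j)"
      using x by (intro power_mono) auto
    also have "exp (1 / ?x) ^ (m + j) = exp (real (m + j) / ?x)"
      by (simp add: exp_of_nat_mult[symmetric])
    also have "\<dots> \<le> exp 1" using x by simp
    finally show ?thesis using x by (simp add: mult_left_mono)
  qed simp
  then have "(?x + 1) ^ (m + j) * (?x + 1) \<le> (?x ^ (m + j) * exp 1) * (?x + 1)"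
    by (rule mult_right_mono) simp
  also have "\<dots> \<le> ((real d + real m) ^ m * exp (real j) * pochhammer (real d + 1 + real m) j * exp 1) * (?x + 1)"
    using Suc.IH by (intro mult_right_mono) auto
  also have "\<dots> = (real d + real m) ^ m * exp (real (Suc j)) * pochhammer (real d + 1 + real m) (Suc j)"
    by (simp add: pochhammer_Suc exp_add algebra_simps)
  finally show ?case by (simp add: algebra_simps)
qed simp

text \<open>The ratio (1 + t)/(2 + t) increases with \<open>t\<close>, so each step decreases the
  right side by no more than the ratio at \<open>t = m\<close>. This accounts for the base (1 +
  m)/(2 + m) in \<open>\<mu>\<close>.\<close>

lemma inverse_succ_geometric_le:
  "((1 + real m) / (2 + real m)) ^ j / (1 + real m) \<le> 1 / (1 + real (m + j))"
proof (induction j)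
  case (Suc j)
  have "((1 + real m) / (2 + real m)) ^ Suc j / (1 + real m) =
      ((1 + real m) / (2 + real m)) * (((1 + real m) / (2 + real m)) ^ j / (1 + real m))"
    by simp
  also have "\<dots> \<le> ((1 + real (m + j)) / (2 + real (m + j))) * (1 / (1 + real (m + j)))"
    using Suc.IH by (intro mult_mono) (auto simp: field_simps)
  also have "\<dots> = 1 / (1 + real (m + Suc j))"
    by (simp add: field_simps)
  finally show ?case .
qed simp

text \<open>\<open>pochhammer 1 j\<close> cancels \<open>fact j\<close>, and
  \<open>fact m * pochhammer (real m + 1) j\<close> is \<open>fact (m + j)\<close>. The two
  preceding lemmas absorb the powers of (1 + m)/(2 + m) and of exp (-1) contained in
  \<open>\<mu>\<close>.\<close>

lemma hypergeometric_term_le: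
  fixes d m j n :: nat and c :: real
  assumes "0 \<le> c" "1 \<le> d"
  defines "\<mu> \<equiv> ((1 + real m) / (2 + real m)) ^ n * c * exp (- 1)"
  shows "c ^ m / ((1 + real m) ^ n * (real d + real m) ^ m * fact m) *
      (pochhammer 1 j / (pochhammer (real m + 1) j * pochhammer (real d + 1 + real m) j) * \<mu> ^ j / fact j)
    \<le> c ^ (m + j) / (fact (m + j) * (1 + real (m + j)) ^ n * (real d + real (m + j)) ^ (m + j))"
proof -
  let ?q = "(1 + real m) / (2 + real m)"
  let ?P = "pochhammer (real d + 1 + real m) j"
  have P: "0 < ?P" by (rule pochhammer_pos) simp
  have D: "0 < real d + real m" "0 < real d + real (m + j)" using assms by auto
  have "(?q ^ j / (1 + real m)) ^ n \<le> (1 / (1 + real (m + j))) ^ n"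
    by (intro power_mono inverse_succ_geometric_le) auto
  then have 1: "(?q ^ n) ^ j / (1 + real m) ^ n \<le> 1 / (1 + real (m + j)) ^ n"
    by (simp add: power_divide power_mult_distrib mult.commute flip: power_mult)
  have "exp (- 1) ^ j = 1 / exp (real j)"
    using exp_of_nat_mult[of j "- 1 :: real"] by (simp add: exp_minus inverse_eq_divide)
  then have "exp (- 1) ^ j / ((real d + real m) ^ m * ?P) = 1 / ((real d + real m) ^ m * exp (real j) * ?P)"
    by (simp add: mult_ac)
  also have "\<dots> \<le> 1 / (real d + real (m + j)) ^ (m + j)"
    using zero_less_power[OF D(2), of "m + j"] add_power_le_exp_pochhammer[of d m j]
    by (intro divide_left_mono mult_pos_pos P zero_less_power D) auto
  finally have 2: "exp (- 1) ^ j / ((real d + real m) ^ m * ?P) \<le> 1 / (real d + real (m + j)) ^ (m + j)" .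
  have "c ^ m / ((1 + real m) ^ n * (real d + real m) ^ m * fact m) *
      (pochhammer 1 j / (pochhammer (real m + 1) j * ?P) * \<mu> ^ j / fact j) =
      c ^ (m + j) / fact (m + j) *
      (((?q ^ n) ^ j / (1 + real m) ^ n) * (exp (- 1) ^ j / ((real d + real m) ^ m * ?P)))"
    unfolding \<mu>_def pochhammer_fact[symmetric] pochhammer_nat_Suc power_mult_distrib power_add
    by (simp add: mult_ac)
  also have "\<dots> \<le> c ^ (m + j) / fact (m + j) *
      ((1 / (1 + real (m + j)) ^ n) * (1 / (real d + real (m + j)) ^ (m + j)))"
    using assms(1) D P by (intro mult_left_mono mult_mono 1 2) auto
  finally show ?thesis by simp
qed

section \<open>Termwise comparison of the two series\<close>

theorem theorem3p2:
  fixes B :: "real^'p::{finite,wellorder}^'d::finite"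
    and \<beta> :: "nat \<Rightarrow> real" and m p d :: nat and N \<mu> :: real
  assumes p: "p = CARD('p)" and d: "d = CARD('d)"
    and "p \<le> d"
    and "rank B = p"
    and "ordered_eigenvalues ((1 / 4) *\<^sub>R (transpose B ** B)) \<beta>"
    and "m \<ge> 1"
    and N: "N = (real p + 2) * (real p - 1) / 2"
    and \<mu>: "\<mu> = ((1 + real m) / (2 + real m)) powr N * 2 * real p * \<beta> p * exp (- 1)"
  shows "langevin_remainder m B \<ge>
           (1 + real m) powr (- N) * (real d + real m) powr (- real m) * (2 * real p * \<beta> p) ^ m / fact m
           * hypergeometric_1F2 1 (real m + 1) (real d + 1 + real m) \<mu>"
proof -
  let ?S = "(1 / 4) *\<^sub>R (transpose B ** B)"
  \<comment> \<open>The exponent \<open>N\<close> as a natural number: \<open>p - 1\<close> from the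
    balanced partition and p(p - 1)/2 from \<open>zonal_identity_ge\<close>.\<close>
  define n where "n = p - 1 + (\<Sum>i<p. p - 1 - i)"
  let ?c = "2 * real p * \<beta> p"
  let ?h = "\<lambda>j. pochhammer 1 j / (pochhammer (real m + 1) j * pochhammer (real d + 1 + real m) j) * \<mu> ^ j / fact j"
  define T where "T k = 1 / fact k * (\<Sum>\<kappa>\<in>partitions k CARD('p).
      zonal \<kappa> ?S / partitional_pochhammer (real CARD('d) / 2) \<kappa>)" for k
  define C where "C = ?c ^ m / ((1 + real m) ^ n * (real d + real m) ^ m * fact m)"
  have p1: "1 \<le> p" using p by (simp add: Suc_leI)
  have "(\<Sum>i<p. p - 1 - i) = (\<Sum>i<p. i)"
    using sum.nat_diff_reindex[of "\<lambda>i. i" p] by simp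
  also have "2 * \<dots> = p * (p - 1)"
  proof (induction p)
    case (Suc q)
    then show ?case by (cases q) auto
  qed simp
  finally have "2 * (\<Sum>i<p. p - 1 - i) = p * (p - 1)" .
  then have "real (2 * n) = real (2 * (p - 1) + p * (p - 1))"
    by (simp only: n_def distrib_left)
  then have "2 * real n = 2 * (real p - 1) + real p * (real p - 1)"
    using p1 by (simp add: of_nat_diff)
  then have n: "real n = N"
    by (simp add: N algebra_simps)
  have S0: "0 \<le> x \<bullet> (?S *v x)" for x
    by (simp add: scaleR_matrix_vector_assoc[symmetric] transpose_times_self_quadratic_form)
  have b: "0 \<le> \<beta> p"
    using ordered_eigenvalues_nonneg[OF S0 assms(5)] by (simp only: p)
  have "transpose ?S = ?S"
    by (simp add: transpose_scalar matrix_transpose_mul)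
  from ordered_eigenvalues_quadratic_form[OF this assms(5)]
  have S: "\<beta> p * (x \<bullet> x) \<le> x \<bullet> (?S *v x)" for x by (simp only: p)
  have c: "0 \<le> ?c" using b by simp
  have \<mu>': "\<mu> = ((1 + real m) / (2 + real m)) ^ n * ?c * exp (- 1)"
    unfolding \<mu> n[symmetric] by (subst powr_realpow) auto
  have le: "C * ?h j \<le> T (m + j)" for j
  proof -
    have "C * ?h j \<le> ?c ^ (m + j) / (fact (m + j) * (1 + real (m + j)) ^ n * (real d + real (m + j)) ^ (m + j))"
      unfolding C_def \<mu>' using hypergeometric_term_le[OF c, of d m n j] p1 \<open>p \<le> d\<close> by simp
    also have "\<dots> \<le> T (m + j)"
      using zonal_series_term_ge[OF S b, of d "m + j"] \<open>p \<le> d\<close> unfolding n_def T_def p d by simp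
    finally show ?thesis .
  qed
  have "0 \<le> C" using c by (auto simp: C_def)
  have "0 \<le> \<mu>" using c by (simp add: \<mu>')
  have h0: "0 \<le> ?h j" for j
    using \<open>0 \<le> \<mu>\<close> by (intro divide_nonneg_nonneg mult_nonneg_nonneg pochhammer_nonneg zero_le_power) auto
  have "summable T"
    unfolding T_def using S0 \<open>p \<le> d\<close> by (intro zonal_series_summable) (auto simp: p d)
  then have sum_T: "summable (\<lambda>j. T (m + j))"
    using summable_ignore_initial_segment[of T m] by (simp add: add.commute)
  \<comment> \<open>Convergence of the scaled hypergeometric series follows from the termwise
    comparison itself.\<close>
  have sum_Ch: "summable (\<lambda>j. C * ?h j)"
  proof (rule summable_comparison_test'[OF sum_T, of 0])
    show "norm (C * ?h j) \<le> T (m + j)" for j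
      unfolding real_norm_def abs_of_nonneg[OF mult_nonneg_nonneg[OF \<open>0 \<le> C\<close> h0]] by (rule le)
  qed
  have "C * (\<Sum>j. ?h j) \<le> (\<Sum>j. T (m + j))"
  \<comment> \<open>Removing the factor \<open>C\<close> from the sum requires it to be nonzero; for
    \<open>C = 0\<close> nonnegativity of the remainder is enough.\<close>
  proof (cases "C = 0")
    case True
    then show ?thesis using le by (auto intro!: suminf_nonneg[OF sum_T])
  next
    case False
    have "summable ?h" by (rule summable_mult_D[OF sum_Ch False])
    then have "C * (\<Sum>j. ?h j) = (\<Sum>j. C * ?h j)" by (rule suminf_mult[symmetric])
    also have "\<dots> \<le> (\<Sum>j. T (m + j))" by (rule suminf_le[OF le sum_Ch sum_T])
    finally show ?thesis .
  qed
  moreover have "C = (1 + real m) powr (- N) * (real d + real m) powr (- real m) * ?c ^ m / fact m"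
    using p1 \<open>p \<le> d\<close> unfolding n[symmetric] C_def
    by (simp only: powr_minus powr_realpow') (simp add: powr_realpow field_simps)
  moreover have "langevin_remainder m B = (\<Sum>j. T (m + j))"
    by (simp only: langevin_remainder_def T_def Let_def)
  ultimately show ?thesis
    by (simp only: hypergeometric_1F2_def)
qed

end
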